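(* Fix a real number $c\ge 0$. For the directed complete graph on $n$ vertices with i.i.d. exponential mean-$1$ arc weights, $$\lim_{n\to\infty}\mathbb P[\text{there exists a cycle with mean weight}\le c/n]=\begin{cases}1-\exp[-T(c)+c] & \text{if } c\le 1/e,\\ 1 & \text{if } c>1/e,\end{cases}$$ while for the undirected complete graph on $n$ vertices with i.i.d. exponential mean-$1$ edge weights, $$\lim_{n\to\infty}\mathbb P[\text{there exists a cycle with mean weight}\le c/n]=\begin{cases}1-\exp[(-T(c)+c+c^2)/2] & \text{if } c\le 1/e,\\ 1 & \text{if } c>1/e.\end{cases}$$
   Context: The directed complete graph on $n$ vertices has one arc for each ordered pair of distinct vertices; its cycles are simple directed cycles, of length $k\ge 2$. The undirected complete graph has one edge for each unordered pair of distinct vertices; its cycles are simple cycles, of length $k\ge3$. Edge (arc) weights are i.i.d. exponential with mean $1$, i.e. $\mathbb P[w_e>x]=e^{-x}$ for $x\ge0$. The mean weight of a cycle is the sum of its edge weights divided by its length (number of edges). The tree function is $T(z)=\sum_{k=1}^\infty k^{k-1}\frac{z^k}{k!}$, convergent for $|z|\le 1/e$. *)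

theory Defs
  imports "HOL-Probability.Probability" "Graph_Theory.Arc_Walk"
begin

definition directed_complete_graph :: "nat \<Rightarrow> (nat, nat \<times> nat) pre_digraph" where
  "directed_complete_graph n =
     \<lparr> verts = {..<n}, arcs = {(u, v). u < n \<and> v < n \<and> u \<noteq> v}, tail = fst, head = snd \<rparr>"

text \<open>A cycle is represented by the list of its arcs, with any choice of the starting point.
  Since the complete graph has no loops, every directed cycle has length at least 2.\<close>

definition directed_cycles :: "nat \<Rightarrow> (nat \<times> nat) list set" where
  "directed_cycles n = {p. pre_digraph.cycle (directed_complete_graph n) p}"

text \<open>An undirected edge is a two-element set of vertices. An undirected cycle, given by the list
  of its edges, is a directed cycle of length at least 3 with the orientation forgotten; the length
  bound excludes going back and forth along one edge.\<close>

definition undirected_edges :: "nat \<Rightarrow> nat set set" where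
  "undirected_edges n = {{u, v} | u v. (u, v) \<in> arcs (directed_complete_graph n)}"

definition undirected_cycles :: "nat \<Rightarrow> nat set list set" where
  "undirected_cycles n = {map (\<lambda>(u, v). {u, v}) p | p. p \<in> directed_cycles n \<and> length p \<ge> 3}"

definition mean_weight :: "('e \<Rightarrow> real) \<Rightarrow> 'e list \<Rightarrow> real" where
  "mean_weight w p = (\<Sum>e\<leftarrow>p. w e) / real (length p)"

definition iid_exponential :: "'a measure \<Rightarrow> 'e set \<Rightarrow> ('e \<Rightarrow> 'a \<Rightarrow> real) \<Rightarrow> bool" where
  "iid_exponential M E w \<longleftrightarrow>
     prob_space M \<and>
     prob_space.indep_vars M (\<lambda>_. borel) w E \<and>
     (\<forall>e\<in>E. distributed M lborel (w e) (exponential_density 1))"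

text \<open>The series starts at exponent 1, hence the shift of the summation index by one
  (the summand \<open>k ^ (k - 1) * z ^ k / fact k\<close> would contribute 1 at \<open>k = 0\<close> in HOL).\<close>

definition tree_function :: "real \<Rightarrow> real" where
  "tree_function z = (\<Sum>j. real (Suc j) ^ j * z ^ Suc j / fact (Suc j))"

end

theory Submission
  imports Defs "HOL-Real_Asymp.Real_Asymp"
begin

text \<open>The expected number of \<open>k\<close>-cycles of mean weight at most \<open>c / n\<close> is bounded by, and tends to,
  \<open>k ^ (k - 1) * c ^ k / k!\<close> (half of it in the undirected case), because a sum of \<open>k\<close> weights
  is at most \<open>x\<close> with probability about \<open>x ^ k / k!\<close>. For a fixed bound \<open>K\<close> on the length, the number
  of such cycles is asymptotically Poisson, at least as far as the probability of the value 0 is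
  concerned: edge weights of a light cycle are \<open>O(1 / n)\<close>, and two meeting cycles span more edges than
  vertices, so that dependent pairs contribute \<open>O(1 / n)\<close>. If \<open>c \<le> 1 / e\<close>, the sum of the
  expectations over \<open>k > K\<close> is small uniformly in \<open>n\<close>, so \<open>K\<close> can be sent to infinity. If
  \<open>c > 1 / e\<close>, the series of expectations diverges, and bounded lengths already give probability
  arbitrarily close to 1.\<close>

text \<open>There are about n^k / k directed cycles of length k, and each has total weight at most k
  c / n with probability about (k c / n)^k / k!; the product is the term of the tree series. By
  Stirling's formula this term behaves like (c e)^k / k^(3/2) up to a constant factor. Hence the
  threshold 1 / e, and hence the threshold itself still belongs to the convergent case. Truncating
  the lengths is what makes the argument work: the constant obtained for the O(1 / n) error grows
  with K, so n goes to infinity while K is fixed, and only then does K. As only the value 0 of the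
  number of light cycles matters, no moments beyond the second are computed: probabilities of single
  events and of dependent pairs suffice.\<close>

section \<open>Poisson approximation\<close>

text \<open>Adding the events one at a time: replacing the event that no earlier \<open>B b\<close> occurs by
  the one that no earlier \<open>B b\<close> independent of \<open>B a\<close> occurs costs only pairs of dependent events.\<close>

lemma (in prob_space) prob_none_poisson_approx:
  fixes B :: "'i \<Rightarrow> 'a set" and R :: "'i \<Rightarrow> 'i \<Rightarrow> bool"
  assumes fin: "finite A"
    and ev: "\<And>a. a \<in> A \<Longrightarrow> B a \<in> events"
    and refl: "\<And>a. a \<in> A \<Longrightarrow> R a a"
    and indep: "\<And>a S. a \<in> A \<Longrightarrow> S \<subseteq> {b \<in> A. \<not> R a b} \<Longrightarrow>
      prob (B a \<inter> (space M - (\<Union>b\<in>S. B b))) = prob (B a) * prob (space M - (\<Union>b\<in>S. B b))"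
  shows "\<bar>prob (space M - (\<Union>a\<in>A. B a)) - exp (- (\<Sum>a\<in>A. prob (B a)))\<bar>
     \<le> (\<Sum>a\<in>A. \<Sum>b\<in>{b\<in>A. R a b}. prob (B a) * prob (B b) + (if b = a then 0 else prob (B a \<inter> B b)))"
  using assms
proof (induction A rule: finite_induct)
  case empty
  then show ?case by (simp add: prob_space)
next
  case (insert a A)
  define h where "h a b = prob (B a) * prob (B b) + (if b = a then 0 else prob (B a \<inter> B b))" for a b
  have h0: "h a b \<ge> 0" for a b by (simp add: h_def)
  define D where "D = (\<Sum>a\<in>A. \<Sum>b\<in>{b\<in>A. R a b}. h a b)"
  define N where "N = space M - (\<Union>b\<in>A. B b)"
  define S where "S = {b\<in>A. \<not> R a b}"
  define N' where "N' = space M - (\<Union>b\<in>S. B b)"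
  define U where "U = (\<Union>b\<in>A-S. B b)"
  have fS: "finite S" "finite (A - S)" using insert.hyps by (auto simp: S_def)
  have [measurable]: "B a \<in> events" using insert.prems by auto
  have evA: "B b \<in> events" if "b \<in> A" for b using insert.prems that by auto
  have [measurable]: "N \<in> events" "N' \<in> events" "U \<in> events"
    unfolding N_def N'_def U_def using evA fS insert.hyps
    by (intro sets.Diff sets.top sets.finite_UN; auto simp: S_def)+
  have IH: "\<bar>prob N - exp (- (\<Sum>a\<in>A. prob (B a)))\<bar> \<le> D"
    unfolding N_def D_def h_def
  proof (rule insert.IH)
    show "prob (B a \<inter> (space M - (\<Union>b\<in>S. B b))) = prob (B a) * prob (space M - (\<Union>b\<in>S. B b))"
      if "a \<in> A" "S \<subseteq> {b \<in> A. \<not> R a b}" for a S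
      using insert.prems(3)[of a S] that by auto
  qed (use insert.prems in auto)
  have eqN: "N' \<inter> - U = N \<inter> - U" "N \<subseteq> N'" "N' - N \<subseteq> U"
    by (auto simp: N_def N'_def U_def S_def)
  have AS: "A - S = {b\<in>A. R a b}" by (auto simp: S_def)
  have N'N: "prob N \<le> prob N'" "prob N' \<le> prob N + prob U"
  proof -
    show "prob N \<le> prob N'" using eqN by (intro finite_measure_mono) auto
    have "prob N' \<le> prob (N \<union> U)" using eqN by (intro finite_measure_mono) auto
    also have "\<dots> \<le> prob N + prob U" by (rule measure_Un_le) auto
    finally show "prob N' \<le> prob N + prob U" .
  qed
  have BN: "prob (B a \<inter> N) \<le> prob (B a \<inter> N')" "prob (B a \<inter> N') \<le> prob (B a \<inter> N) + prob (B a \<inter> U)"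
  proof -
    show "prob (B a \<inter> N) \<le> prob (B a \<inter> N')" using eqN by (intro finite_measure_mono) auto
    have "prob (B a \<inter> N') \<le> prob ((B a \<inter> N) \<union> (B a \<inter> U))" using eqN by (intro finite_measure_mono) auto
    also have "\<dots> \<le> prob (B a \<inter> N) + prob (B a \<inter> U)" by (rule measure_Un_le) auto
    finally show "prob (B a \<inter> N') \<le> prob (B a \<inter> N) + prob (B a \<inter> U)" .
  qed
  have ind: "prob (B a \<inter> N') = prob (B a) * prob N'"
    unfolding N'_def by (rule insert.prems(3)) (use insert in \<open>auto simp: S_def\<close>)
  have U: "prob U \<le> (\<Sum>b\<in>A-S. prob (B b))"
    unfolding U_def using fS evA by (intro finite_measure_subadditive_finite) auto
  have "prob (B a \<inter> U) = prob (\<Union>b\<in>A-S. B a \<inter> B b)"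
    unfolding U_def by (intro arg_cong[where f=prob]) auto
  also have "\<dots> \<le> (\<Sum>b\<in>A-S. prob (B a \<inter> B b))"
    using fS evA by (intro finite_measure_subadditive_finite) auto
  finally have BU: "prob (B a \<inter> U) \<le> (\<Sum>b\<in>A-S. prob (B a \<inter> B b))" .
  define p where "p = prob (B a)"
  have p: "0 \<le> p" "p \<le> 1" by (auto simp: p_def)
  define e where "e = exp (- (\<Sum>a\<in>A. prob (B a)))"
  have e: "0 \<le> e" "e \<le> 1" unfolding e_def by (auto intro: sum_nonneg)
  have ep: "1 - p \<le> exp (-p)" using exp_ge_add_one_self[of "-p"] by simp
  have ep2: "exp (-p) \<le> 1 - p + p^2"
  proof -
    have "exp (-p) * (1 + p) \<le> exp (-p) * exp p"
      by (intro mult_left_mono exp_ge_add_one_self_aux) (use p in auto)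
    also have "\<dots> = 1" by (simp flip: exp_add)
    finally have "exp (-p) \<le> 1 / (1 + p)" using p by (simp add: field_simps)
    also have "\<dots> \<le> 1 - p + p^2"
    proof -
      have "(1 - p + p^2) * (1 + p) = 1 + p^3" by (simp add: algebra_simps power2_eq_square power3_eq_cube)
      then have "1 \<le> (1 - p + p^2) * (1 + p)" using p by simp
      then show ?thesis using p by (simp add: field_simps)
    qed
    finally show ?thesis .
  qed
  have "prob (N - B a) = prob N - prob (N \<inter> B a)"
    by (rule finite_measure_Diff') auto
  then have st: "prob (N - B a) = prob N - prob (B a \<inter> N)" by (simp add: Int_commute)
  have hsum: "p * prob U + prob (B a \<inter> U) \<le> (\<Sum>b\<in>{b\<in>A. R a b}. h a b)"
  proof -
    have "p * prob U + prob (B a \<inter> U) \<le> p * (\<Sum>b\<in>A-S. prob (B b)) + (\<Sum>b\<in>A-S. prob (B a \<inter> B b))"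
      by (intro add_mono mult_left_mono U BU p)
    also have "\<dots> = (\<Sum>b\<in>A-S. h a b)"
      unfolding sum_distrib_left sum.distrib[symmetric] h_def p_def
      using insert.hyps by (intro sum.cong) auto
    finally show ?thesis by (simp add: AS)
  qed
  \<comment> \<open>The diagonal entry has no intersection term: it only has to absorb the error of
    \<open>1 - p\<close> against \<open>exp (-p)\<close>, which is at most
    \<open>p^2\<close>.\<close>
  have haa: "h a a = p^2" by (simp add: h_def p_def power2_eq_square)
  \<comment> \<open>Three replacements: \<open>prob (N - B a)\<close> by
    \<open>(1-p) * prob N\<close>, where independence holds for \<open>N'\<close> and the passage
    from \<open>N'\<close> to \<open>N\<close> costs the two terms with \<open>U\<close>; then
    \<open>prob N\<close> by \<open>e\<close>, where the factor \<open>1-p\<close> does not enlarge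
    the error \<open>D\<close>; then \<open>1-p\<close> by \<open>exp (-p)\<close>.\<close>
  have key: "\<bar>prob (N - B a) - exp (-p) * e\<bar> \<le> D + (p * prob U + prob (B a \<inter> U)) + p^2"
  proof -
    have q: "prob (B a \<inter> N') = p * prob N'" using ind p_def by simp
    have m1: "p * prob N \<le> p * prob N'" "p * prob N' \<le> p * (prob N + prob U)"
      using p N'N by (auto intro: mult_left_mono)
    have "\<bar>prob (N - B a) - (1-p) * prob N\<bar> \<le> p * prob U + prob (B a \<inter> U)"
      using st BN q m1 p measure_nonneg[of M U] measure_nonneg[of M "B a \<inter> U"]
      by (auto simp: algebra_simps abs_le_iff)
    moreover have "\<bar>(1-p) * prob N - (1-p) * e\<bar> \<le> D"
    proof -
      have "\<bar>(1-p) * prob N - (1-p) * e\<bar> = (1-p) * \<bar>prob N - e\<bar>"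
        using p by (simp add: abs_mult flip: right_diff_distrib)
      also have "\<dots> \<le> 1 * \<bar>prob N - e\<bar>" using p by (intro mult_right_mono) auto
      finally show ?thesis using IH by (simp add: e_def)
    qed
    moreover have "\<bar>(1-p) * e - exp (-p) * e\<bar> \<le> p^2"
    proof -
      have "\<bar>(1-p) * e - exp (-p) * e\<bar> = \<bar>(1-p) - exp (-p)\<bar> * e"
        using e by (simp add: abs_mult flip: left_diff_distrib)
      also have "\<dots> \<le> p^2 * 1" using ep ep2 e by (intro mult_mono) auto
      finally show ?thesis by simp
    qed
    ultimately show ?thesis by linarith
  qed
  \<comment> \<open>The new event accounts for its own row of the double sum; the entries it adds to
    the earlier rows are nonnegative.\<close>
  have "D + (\<Sum>b\<in>{b\<in>A. R a b}. h a b) + h a a \<le>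
     (\<Sum>a'\<in>insert a A. \<Sum>b\<in>{b\<in>insert a A. R a' b}. h a' b)"
  proof -
    have "{b\<in>insert a A. R a b} = insert a {b\<in>A. R a b}" using insert.prems by auto
    then have "(\<Sum>b\<in>{b\<in>insert a A. R a b}. h a b) = h a a + (\<Sum>b\<in>{b\<in>A. R a b}. h a b)"
      using insert.hyps by simp
    moreover have "D \<le> (\<Sum>a'\<in>A. \<Sum>b\<in>{b\<in>insert a A. R a' b}. h a' b)"
      unfolding D_def using insert.hyps h0 by (intro sum_mono sum_mono2) auto
    ultimately show ?thesis using insert.hyps by simp
  qed
  moreover have "space M - (\<Union>b\<in>insert a A. B b) = N - B a" by (auto simp: N_def)
  moreover have "exp (- (\<Sum>b\<in>insert a A. prob (B b))) = exp (-p) * e"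
    using insert.hyps by (simp add: p_def e_def flip: exp_add)
  ultimately show ?case using key hsum haa unfolding h_def by simp
qed

text \<open>Here \<open>erlang_CDF (k - 1) 1\<close> is the distribution function of a sum of \<open>k\<close> weights.\<close>

lemma erlang_CDF_bounds:
  assumes "x \<ge> 0" "k \<ge> 1"
  shows "erlang_CDF (k - 1) 1 x \<le> x ^ k / fact k"
    and "exp (- 2 * x) * x ^ k / fact k \<le> erlang_CDF (k - 1) 1 x"
proof -
  \<comment> \<open>The distribution function is \<open>exp (- x)\<close> times the Taylor remainder
    of the exponential series at order \<open>k\<close>. In Lagrange form this leaves the factor
    \<open>exp (t - x)\<close> with \<open>\<bar>t\<bar> \<le> x\<close>, which lies between
    \<open>exp (- 2 * x)\<close> and 1.\<close>
  obtain t where t: "\<bar>t\<bar> \<le> \<bar>x\<bar>" "exp x = (\<Sum>m<k. x ^ m / fact m) + exp t / fact k * x ^ k"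
    using Maclaurin_exp_le[of x k] by blast
  have "erlang_CDF (k - 1) 1 x = 1 - (\<Sum>n\<le>k-1. x ^ n / fact n) * exp (- x)"
    using assms by (simp add: erlang_CDF_def sum_distrib_right)
  also have "{..k-1} = {..<k}" using assms by auto
  also have "(\<Sum>n<k. x ^ n / fact n) = exp x - exp t / fact k * x ^ k" using t by simp
  also have "1 - (exp x - exp t / fact k * x ^ k) * exp (- x) = exp (t - x) * x ^ k / fact k"
    by (simp add: algebra_simps exp_diff exp_minus divide_inverse)
  finally have eq: "erlang_CDF (k - 1) 1 x = exp (t - x) * x ^ k / fact k" .
  have "exp (t - x) * x ^ k / fact k \<le> 1 * x ^ k / fact k"
    using t assms by (intro divide_right_mono mult_right_mono) auto
  then show "erlang_CDF (k - 1) 1 x \<le> x ^ k / fact k" unfolding eq by simp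
  show "exp (- 2 * x) * x ^ k / fact k \<le> erlang_CDF (k - 1) 1 x"
    unfolding eq using t assms by (intro divide_right_mono mult_right_mono) auto
qed

text \<open>The numerator is the falling factorial, a product of \<open>k\<close> factors each
  asymptotic to \<open>n\<close>.\<close>

lemma binomial_fact_asymp: "(\<lambda>n. real (n choose k) * fact k / real n ^ k) \<longlonglongrightarrow> 1"
proof -
  have "(\<lambda>n. \<Prod>i=0..<k. (real n - real i) / real n) \<longlonglongrightarrow> (\<Prod>i=0..<k. 1)"
    by (intro tendsto_prod) real_asymp
  moreover have "(\<Prod>i=0..<k. (real n - real i) / real n) = real (n choose k) * fact k / real n ^ k" for n
    by (simp add: binomial_gbinomial gbinomial_mult_fact' prod_dividef)
  ultimately show ?thesis by simp
qed

section \<open>The series of the tree function\<close>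

text \<open>The limit, as the number of vertices grows, of the expected number of directed \<open>k\<close>-cycles of
  mean weight at most \<open>c\<close> over the number of vertices; at \<open>k = 0\<close> it is \<open>1 / 0 = 0\<close>.\<close>

definition tree_term :: "real \<Rightarrow> nat \<Rightarrow> real" where
  "tree_term c k = (real k * c) ^ k / (real k * fact k)"

lemma tree_term_0 [simp]: "tree_term c 0 = 0"
  by (simp add: tree_term_def)

lemma tree_term_nonneg: "c \<ge> 0 \<Longrightarrow> tree_term c k \<ge> 0"
  by (simp add: tree_term_def)

lemma tree_term_Suc: "tree_term c (Suc j) = real (Suc j) ^ j * c ^ Suc j / fact (Suc j)"
  by (simp add: tree_term_def power_mult_distrib divide_simps del: of_nat_Suc fact_Suc)

text \<open>The quotient has the earlier term on top, as the tests of Raabe and d'Alembert are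
  stated for it. It tends to 1 / (e c). The indices start at 1 because the term at 0
  vanishes.\<close>

lemma tree_term_ratio:
  assumes "c > 0"
  shows "tree_term c (Suc n) / tree_term c (Suc (Suc n)) = (real (n + 1) / real (n + 2)) ^ n / c"
proof -
  have "fact (Suc (Suc n)) = real (n + 2) * fact (Suc n)" by (simp)
  then show ?thesis using assms
    by (simp add: tree_term_Suc divide_simps del: of_nat_Suc fact_Suc)
qed

text \<open>At \<open>1 / exp 1\<close> the ratio of consecutive terms tends to 1 and the ratio test
  is silent, so Raabe's test decides; smaller \<open>c\<close> follow by comparison.\<close>

lemma summable_tree_term:
  assumes "0 \<le> c" "c \<le> 1 / exp 1"
  shows "summable (tree_term c)"
proof -
  define d :: real where "d = 1 / exp 1"
  have d: "d > 0" by (simp add: d_def)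
  define g where "g n = 1 + real n * ln (real (n + 1) / real (n + 2))" for n
  \<comment> \<open>\<open>g n\<close> is the logarithm of the ratio, so the ratio minus 1 is at
    least \<open>g n\<close>. The limit 3/2 is the decay exponent from Stirling's formula; being
    above 1, it gives convergence.\<close>
  have "(\<lambda>n. real n * g n) \<longlonglongrightarrow> 3 / 2" unfolding g_def by real_asymp
  then have lim: "liminf (\<lambda>n. ereal (real n * g n)) = ereal (3 / 2)"
    by (intro lim_imp_Liminf) auto
  have "real n * g n \<le> real n * (tree_term d (Suc n) / tree_term d (Suc (Suc n)) - 1)" for n
  proof -
    have "tree_term d (Suc n) / tree_term d (Suc (Suc n)) = exp (g n)"
      unfolding tree_term_ratio[OF d] g_def by (simp add: exp_add d_def exp_of_nat_mult)
    then show ?thesis using exp_ge_add_one_self[of "g n"] by (intro mult_left_mono) linarith+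
  qed
  then have "liminf (\<lambda>n. ereal (real n * g n)) \<le>
      liminf (\<lambda>n. ereal (real n * (tree_term d (Suc n) / tree_term d (Suc (Suc n)) - 1)))"
    by (intro Liminf_mono always_eventually) auto
  then have "1 < liminf (\<lambda>n. ereal (real n * (tree_term d (Suc n) / tree_term d (Suc (Suc n)) - 1)))"
    unfolding lim by (rule less_le_trans[rotated]) (simp add: one_ereal_def)
  then have "summable (\<lambda>n. tree_term d (Suc n))"
    using d by (intro raabes_test_convergence) (auto simp: tree_term_def one_ereal_def simp del: fact_Suc)
  then have "summable (tree_term d)" by (subst (asm) summable_Suc_iff)
  moreover have "norm (tree_term c n) \<le> tree_term d n" for n
  proof -
    have "(real n * c) ^ n \<le> (real n * d) ^ n" using assms by (intro power_mono mult_left_mono) (auto simp: d_def)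
    then show ?thesis using assms by (auto simp: tree_term_def intro!: divide_right_mono)
  qed
  ultimately show ?thesis by (rule summable_comparison_test'[where N = 0])
qed

lemma not_summable_tree_term:
  assumes "c > 1 / exp 1"
  shows "\<not> summable (tree_term c)"
proof -
  have c: "c > 0" using assms by (smt (verit) divide_pos_pos exp_gt_zero)
  have "(\<lambda>n. ereal (tree_term c (Suc n) / tree_term c (Suc (Suc n)))) \<longlonglongrightarrow> ereal (1 / exp 1 / c)"
    unfolding tree_term_ratio[OF c] lim_ereal
  proof (intro tendsto_divide tendsto_const)
    show "(\<lambda>n. (real (n + 1) / real (n + 2)) ^ n) \<longlonglongrightarrow> 1 / exp 1"
      using exp_minus[of "1::real"] by (simp only: inverse_eq_divide[symmetric] flip: exp_minus) real_asymp
  qed (use c in auto)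
  then have "limsup (\<lambda>n. ereal (tree_term c (Suc n) / tree_term c (Suc (Suc n)))) = ereal (1 / exp 1 / c)"
    by (intro lim_imp_Limsup) auto
  moreover have "1 / exp 1 / c < 1" using assms c by (simp add: field_simps)
  ultimately have "\<not> summable (\<lambda>n. tree_term c (Suc n))"
    using c by (intro ratio_test_divergence) (auto simp: tree_term_def one_ereal_def simp del: fact_Suc)
  then show ?thesis by (simp add: summable_Suc_iff)
qed

section \<open>Sums of independent exponential weights\<close>

context
  fixes M :: "'a measure" and E :: "'e set" and w :: "'e \<Rightarrow> 'a \<Rightarrow> real"
  assumes iid: "iid_exponential M E w"
begin

interpretation prob_space M
  using iid by (simp add: iid_exponential_def)

lemma iid_exponential_indep_vars: "indep_vars (\<lambda>_. borel) w E"
  using iid by (simp add: iid_exponential_def)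

lemma iid_exponential_borel_measurable [measurable_dest]: "e \<in> E \<Longrightarrow> w e \<in> borel_measurable M"
  using iid_exponential_indep_vars by (simp add: indep_vars_def2)

lemma iid_exponential_sum_sets:
  assumes "F \<subseteq> E"
  shows "{\<omega> \<in> space M. (\<Sum>e\<in>F. w e \<omega>) \<le> t} \<in> sets M"
proof -
  have "(\<lambda>\<omega>. \<Sum>e\<in>F. w e \<omega>) \<in> borel_measurable M"
    using assms iid_exponential_borel_measurable by (intro borel_measurable_sum) auto
  then show ?thesis by measurable
qed

lemma iid_exponential_AE_nonneg:
  assumes "e \<in> E"
  shows "AE \<omega> in M. 0 \<le> w e \<omega>"
proof -
  have D: "distributed M lborel (w e) (exponential_density 1)"
    using iid assms by (simp add: iid_exponential_def)
  have "prob {\<omega> \<in> space M. 0 < w e \<omega>} = 1"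
    using exponential_distributedD_gt[OF D, of 0] by simp
  then have "AE \<omega> in M. 0 < w e \<omega>"
    by (subst (asm) prob_Collect_eq_1) (use iid_exponential_borel_measurable[OF assms] in measurable)
  then show ?thesis by eventually_elim simp
qed

lemma iid_exponential_all_le:
  assumes F: "F \<subseteq> E" "finite F" and t: "0 \<le> t"
  shows "prob {\<omega> \<in> space M. \<forall>e\<in>F. w e \<omega> \<le> t} \<le> t ^ card F"
proof (cases "F = {}")
  case False
  have "{\<omega> \<in> space M. \<forall>e\<in>F. w e \<omega> \<le> t} = (\<Inter>e\<in>F. w e -` {..t} \<inter> space M)"
    using False by auto
  then have "prob {\<omega> \<in> space M. \<forall>e\<in>F. w e \<omega> \<le> t} = (\<Prod>e\<in>F. prob (w e -` {..t} \<inter> space M))"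
    using indep_varsD[OF iid_exponential_indep_vars False F(2,1), of "\<lambda>_. {..t}"] by simp
  also have "\<dots> \<le> (\<Prod>e\<in>F. t)"
  proof (intro prod_mono conjI measure_nonneg)
    fix e assume "e \<in> F"
    then have D: "distributed M lborel (w e) (exponential_density 1)"
      using iid F by (auto simp: iid_exponential_def)
    have "w e -` {..t} \<inter> space M = {\<omega> \<in> space M. w e \<omega> \<le> t}" by auto
    then have "prob (w e -` {..t} \<inter> space M) = 1 - exp (- t)"
      using exponential_distributedD_le[OF D t] by simp
    also have "\<dots> \<le> t" using exp_ge_add_one_self[of "- t"] by simp
    finally show "prob (w e -` {..t} \<inter> space M) \<le> t" .
  qed
  finally show ?thesis by simp
qed (simp add: prob_space)

text \<open>Weights are almost surely nonnegative, so a sum of at most \<open>t\<close> forces each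
  of its summands to be at most \<open>t\<close>. This turns two overlapping sums into a condition
  on the independent weights over \<open>F \<union> G\<close>. The factorials lost in this way do
  not matter, since only the power of \<open>t\<close> will.\<close>

lemma iid_exponential_two_sums_le:
  assumes F: "F \<subseteq> E" "finite F" and G: "G \<subseteq> E" "finite G" and t: "0 \<le> t" "s \<le> t" "s' \<le> t"
  shows "prob ({\<omega> \<in> space M. (\<Sum>e\<in>F. w e \<omega>) \<le> s} \<inter> {\<omega> \<in> space M. (\<Sum>e\<in>G. w e \<omega>) \<le> s'}) \<le> t ^ card (F \<union> G)"
proof -
  have "AE \<omega> in M. \<forall>e\<in>F\<union>G. 0 \<le> w e \<omega>"
    using F G iid_exponential_AE_nonneg by (intro AE_finite_allI) auto
  then have "AE \<omega> in M. \<omega> \<in> {\<omega> \<in> space M. (\<Sum>e\<in>F. w e \<omega>) \<le> s} \<inter> {\<omega> \<in> space M. (\<Sum>e\<in>G. w e \<omega>) \<le> s'}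
     \<longrightarrow> \<omega> \<in> {\<omega> \<in> space M. \<forall>e\<in>F\<union>G. w e \<omega> \<le> t}"
  proof eventually_elim
    case (elim \<omega>)
    have "w e \<omega> \<le> t" if "H \<subseteq> F \<union> G" "finite H" "(\<Sum>e\<in>H. w e \<omega>) \<le> t" "e \<in> H" for H e
      using member_le_sum[of e H "\<lambda>e. w e \<omega>"] that elim by force
    from this[of F] this[of G] show ?case using t F G by auto
  qed
  moreover have "{\<omega> \<in> space M. \<forall>e\<in>F\<union>G. w e \<omega> \<le> t} \<in> events"
    using F G iid_exponential_borel_measurable
    by (intro sets.sets_Collect_finite_All borel_measurable_le) auto
  ultimately have "prob ({\<omega> \<in> space M. (\<Sum>e\<in>F. w e \<omega>) \<le> s} \<inter> {\<omega> \<in> space M. (\<Sum>e\<in>G. w e \<omega>) \<le> s'})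
      \<le> prob {\<omega> \<in> space M. \<forall>e\<in>F\<union>G. w e \<omega> \<le> t}"
    by (rule finite_measure_mono_AE)
  also have "\<dots> \<le> t ^ card (F \<union> G)" using F G t by (intro iid_exponential_all_le) auto
  finally show ?thesis .
qed

lemma iid_exponential_sum_le:
  assumes "F \<subseteq> E" "finite F" "F \<noteq> {}" "0 \<le> t"
  shows "prob {\<omega> \<in> space M. (\<Sum>e\<in>F. w e \<omega>) \<le> t} = erlang_CDF (card F - 1) 1 t"
proof (rule erlang_distributed_le)
  show "distributed M lborel (\<lambda>\<omega>. \<Sum>e\<in>F. w e \<omega>) (erlang_density (card F - 1) 1)"
  proof (rule exponential_distributed_sum[OF assms(2,3)])
    show "distributed M lborel (w e) (exponential_density 1)" if "e \<in> F" for e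
      using iid assms that by (auto simp: iid_exponential_def)
    show "indep_vars (\<lambda>_. borel) w F"
      using indep_vars_subset[OF iid_exponential_indep_vars assms(1)] .
  qed simp
qed (use assms in auto)

text \<open>This provides the independence hypothesis of \<open>prob_none_poisson_approx\<close>.
  The first event depends only on the weights over \<open>F\<close>, the second only on those over
  the union \<open>H\<close> of all \<open>G i\<close>, and the two restricted weight families are
  independent because \<open>F\<close> and \<open>H\<close> are disjoint.\<close>

lemma iid_exponential_indep_sums:
  assumes F: "F \<subseteq> E" and I: "finite I" and G: "\<And>i. i \<in> I \<Longrightarrow> G i \<subseteq> E \<and> G i \<inter> F = {}"
  defines "B \<equiv> \<lambda>H s. {\<omega> \<in> space M. (\<Sum>e\<in>H. w e \<omega>) \<le> (s::real)}"
  shows "prob (B F s \<inter> (space M - (\<Union>i\<in>I. B (G i) (t i)))) = prob (B F s) * prob (space M - (\<Union>i\<in>I. B (G i) (t i)))"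
proof -
  define H where "H = (\<Union>i\<in>I. G i)"
  have "indep_var (PiM F (\<lambda>_. borel)) (\<lambda>\<omega>. restrict (\<lambda>e. w e \<omega>) F) (PiM H (\<lambda>_. borel)) (\<lambda>\<omega>. restrict (\<lambda>e. w e \<omega>) H)"
    using F G by (intro indep_var_restrict[OF iid_exponential_indep_vars]) (auto simp: H_def)
  moreover define X where "X = {f \<in> space (PiM F (\<lambda>_. borel :: real measure)). (\<Sum>e\<in>F. f e) \<le> s}"
  moreover define Y where "Y = {f \<in> space (PiM H (\<lambda>_. borel :: real measure)). \<forall>i\<in>I. t i < (\<Sum>e\<in>G i. f e)}"
  moreover have "X \<in> sets (PiM F (\<lambda>_. borel))"
    unfolding X_def by (intro borel_measurable_le borel_measurable_sum) measurable
  moreover have "Y \<in> sets (PiM H (\<lambda>_. borel))"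
    unfolding Y_def
    by (intro sets.sets_Collect_finite_All I borel_measurable_less borel_measurable_sum
        borel_measurable_const measurable_component_singleton) (auto simp: H_def)
  ultimately have "prob ((\<lambda>\<omega>. (restrict (\<lambda>e. w e \<omega>) F, restrict (\<lambda>e. w e \<omega>) H)) -` (X \<times> Y) \<inter> space M) =
      prob ((\<lambda>\<omega>. restrict (\<lambda>e. w e \<omega>) F) -` X \<inter> space M) * prob ((\<lambda>\<omega>. restrict (\<lambda>e. w e \<omega>) H) -` Y \<inter> space M)"
    by (intro indep_varD)
  moreover have XX: "(\<lambda>\<omega>. restrict (\<lambda>e. w e \<omega>) F) -` X \<inter> space M = B F s"
    by (auto simp: X_def B_def space_PiM)
  moreover have YY: "(\<lambda>\<omega>. restrict (\<lambda>e. w e \<omega>) H) -` Y \<inter> space M = space M - (\<Union>i\<in>I. B (G i) (t i))"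
  proof -
    have "(\<Sum>e\<in>G i. restrict (\<lambda>e. w e \<omega>) H e) = (\<Sum>e\<in>G i. w e \<omega>)" if "i \<in> I" for i \<omega>
      using that by (intro sum.cong) (auto simp: H_def)
    then show ?thesis by (force simp: Y_def B_def space_PiM not_le)
  qed
  moreover have "(\<lambda>\<omega>. (restrict (\<lambda>e. w e \<omega>) F, restrict (\<lambda>e. w e \<omega>) H)) -` (X \<times> Y) \<inter> space M
     = ((\<lambda>\<omega>. restrict (\<lambda>e. w e \<omega>) F) -` X \<inter> space M) \<inter> ((\<lambda>\<omega>. restrict (\<lambda>e. w e \<omega>) H) -` Y \<inter> space M)"
    by auto
  ultimately show ?thesis by simp
qed

end

section \<open>Cycles as vertex lists\<close>

text \<open>Zipping with the rotated list pairs every vertex with its cyclic successor, so the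
  closing arc needs no separate treatment.\<close>

definition cyc_arcs :: "'v list \<Rightarrow> ('v \<times> 'v) set" where
  "cyc_arcs xs = set (zip xs (rotate1 xs))"

lemma cyc_arcs_conv_nth:
  "cyc_arcs xs = (\<lambda>i. (xs ! i, xs ! (Suc i mod length xs))) ` {..<length xs}"
  by (auto simp: cyc_arcs_def set_zip nth_rotate1)

lemma fst_cyc_arcs: "fst ` cyc_arcs xs = set xs"
  unfolding cyc_arcs_def set_map[symmetric] by (simp del: set_map)

lemma snd_cyc_arcs: "snd ` cyc_arcs xs = set xs"
  unfolding cyc_arcs_def set_map[symmetric] by (simp del: set_map)

lemma cyc_arcsD:
  assumes "(u, v) \<in> cyc_arcs xs"
  shows "u \<in> set xs" "v \<in> set xs"
  using imageI[OF assms, of fst] imageI[OF assms, of snd] by (simp_all add: fst_cyc_arcs snd_cyc_arcs)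

lemma finite_cyc_arcs [simp]: "finite (cyc_arcs xs)"
  by (simp add: cyc_arcs_def)

lemma inj_on_fst_cyc_arcs: "distinct xs \<Longrightarrow> inj_on fst (cyc_arcs xs)"
  by (auto simp: cyc_arcs_conv_nth inj_on_def nth_eq_iff_index_eq)

lemma card_cyc_arcs: "distinct xs \<Longrightarrow> card (cyc_arcs xs) = length xs"
  using card_image[OF inj_on_fst_cyc_arcs, of xs] by (simp add: fst_cyc_arcs distinct_card)

lemma cyc_arcs_rotate: "cyc_arcs (rotate i xs) = cyc_arcs xs"
proof (induction i)
  case (Suc i)
  have "zip (rotate1 ys) (rotate1 zs) = rotate1 (zip ys zs)" if "length ys = length zs" for ys zs :: "'a list"
    using that by (cases ys; cases zs) auto
  from this[of "rotate i xs" "rotate1 (rotate i xs)"] show ?case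
    using Suc by (simp add: cyc_arcs_def)
qed simp

text \<open>Up to a rotation, \<open>rev xs\<close> equals \<open>rev (rotate1 xs)\<close>, so
  reversal amounts to exchanging the two lists that are zipped.\<close>

lemma cyc_arcs_rev: "cyc_arcs (rev xs) = (\<lambda>(u, v). (v, u)) ` cyc_arcs xs"
proof (cases xs)
  case (Cons x ys)
  define zs where "zs = rotate1 xs"
  have "cyc_arcs (rev xs) = cyc_arcs (rotate1 (rev zs))"
    by (simp add: zs_def Cons)
  also have "\<dots> = cyc_arcs (rev zs)" using cyc_arcs_rotate[of 1] by simp
  also have "rotate1 (rev zs) = rev xs" by (simp add: zs_def Cons)
  then have "cyc_arcs (rev zs) = set (rev (zip zs xs))"
    by (simp add: cyc_arcs_def zs_def zip_rev del: set_rev)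
  also have "\<dots> = (\<lambda>(u, v). (v, u)) ` cyc_arcs xs"
    by (auto simp: cyc_arcs_def zs_def set_zip image_iff)
  finally show ?thesis .
qed (simp add: cyc_arcs_def)

lemma cyc_arcs_irrefl:
  assumes "distinct xs" "length xs \<ge> 2" "(u, v) \<in> cyc_arcs xs"
  shows "u \<noteq> v"
proof -
  obtain i where i: "i < length xs" "u = xs ! i" "v = xs ! (Suc i mod length xs)"
    using assms by (auto simp: cyc_arcs_conv_nth)
  have "Suc i mod length xs \<noteq> i" using assms(2) i(1) by (cases "Suc i = length xs") auto
  moreover have "Suc i mod length xs < length xs" using assms(2) by (intro mod_less_divisor) linarith
  ultimately show ?thesis using i assms(1) by (simp add: nth_eq_iff_index_eq)
qed

lemma cyc_arcs_closed:
  assumes "x \<in> set xs" "x \<in> S" "\<And>u v. (u, v) \<in> cyc_arcs xs \<Longrightarrow> u \<in> S \<Longrightarrow> v \<in> S"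
  shows "set xs \<subseteq> S"
proof -
  let ?k = "length xs"
  obtain i where i: "i < ?k" "xs ! i \<in> S" using assms by (auto simp: in_set_conv_nth)
  have *: "xs ! ((i + j) mod ?k) \<in> S" for j
  proof (induction j)
    case (Suc j)
    have lt: "(i + j) mod ?k < ?k" using i by (intro mod_less_divisor) linarith
    have "(xs ! ((i + j) mod ?k), xs ! (Suc ((i + j) mod ?k) mod ?k)) \<in> cyc_arcs xs"
      using lt by (auto simp: cyc_arcs_conv_nth)
    with assms(3) Suc show ?case by (simp add: mod_Suc_eq)
  qed (use i in simp)
  show ?thesis
  proof
    fix y assume "y \<in> set xs"
    then obtain j where j: "j < ?k" "y = xs ! j" by (auto simp: in_set_conv_nth)
    \<comment> \<open>The number of steps from position \<open>i\<close> round to position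
      \<open>j\<close>; the added \<open>?k\<close> keeps the natural subtraction from being cut
      off.\<close>
    have "(i + (?k + j - i)) mod ?k = j" using i j by simp
    with *[of "?k + j - i"] j show "y \<in> S" by simp
  qed
qed

lemma rotate_to_hd:
  assumes "x \<in> set xs"
  obtains i where "hd (rotate i xs) = x"
proof -
  obtain i where "i < length xs" "xs ! i = x" using assms by (auto simp: in_set_conv_nth)
  then show ?thesis using that[of i] hd_rotate_conv_nth[of xs i] by (cases "xs = []") auto
qed

text \<open>A directed cycle is represented by its vertex list starting at the least vertex, and an
  undirected one by the orientation in which the second vertex is smaller than the last; these
  choices make the representation unique.\<close>

definition rooted_cycles :: "nat \<Rightarrow> nat list set" where
  "rooted_cycles n = {xs. distinct xs \<and> set xs \<subseteq> {..<n} \<and> 2 \<le> length xs \<and> (\<forall>y\<in>set xs. hd xs \<le> y)}"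

definition oriented_cycles :: "nat \<Rightarrow> nat list set" where
  "oriented_cycles n = {xs \<in> rooted_cycles n. 3 \<le> length xs \<and> xs ! 1 < last xs}"

section \<open>The number of cycles of a given length\<close>

lemma card_rooted_cycles:
  assumes "2 \<le> k"
  shows "card {xs \<in> rooted_cycles n. length xs = k} = (n choose k) * fact (k - 1)"
proof -
  \<comment> \<open>A rooted cycle is a vertex set \<open>S\<close> with an arbitrary arrangement of
    its vertices other than the root \<open>Min S\<close>, whence the factor
    \<open>fact (k - 1)\<close>.\<close>
  define T where "T = (SIGMA S:{S. S \<subseteq> {..<n} \<and> card S = k}. permutations_of_set (S - {Min S}))"
  have fin: "finite S" if "S \<subseteq> {..<n}" for S using that finite_subset by blast
  have "bij_betw (\<lambda>(S, ys). Min S # ys) T {xs \<in> rooted_cycles n. length xs = k}"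
  proof (rule bij_betwI[where g = "\<lambda>xs. (set xs, tl xs)"])
    show "(\<lambda>(S, ys). Min S # ys) \<in> T \<rightarrow> {xs \<in> rooted_cycles n. length xs = k}"
    proof (safe)
      fix S ys assume "(S, ys) \<in> T"
      then have S: "S \<subseteq> {..<n}" "card S = k" "set ys = S - {Min S}" "distinct ys"
        by (auto simp: T_def permutations_of_set_def)
      have ne: "finite S" "S \<noteq> {}" using S assms fin by auto
      then have m: "Min S \<in> S" by simp
      have "length ys = card (set ys)" using distinct_card[OF S(4)] by simp
      also have "\<dots> = k - 1" using S m ne by (simp add: card_Diff_singleton)
      finally have l: "length ys = k - 1" .
      have "Min S < n" using m S by auto
      then show "Min S # ys \<in> rooted_cycles n" using S ne m l assms
        by (auto simp: rooted_cycles_def)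
      show "length (Min S # ys) = k" using l assms by simp
    qed
    show "(\<lambda>xs. (set xs, tl xs)) \<in> {xs \<in> rooted_cycles n. length xs = k} \<rightarrow> T"
    proof safe
      fix xs assume xs: "xs \<in> rooted_cycles n" "k = length xs"
      then obtain x ys where [simp]: "xs = x # ys" by (cases xs) (auto simp: rooted_cycles_def)
      have "Min (set xs) = x" using xs by (intro Min_eqI) (auto simp: rooted_cycles_def)
      then show "(set xs, tl xs) \<in> T" using xs
        by (auto simp: T_def rooted_cycles_def permutations_of_set_def distinct_card)
    qed
    show "(case (case p of (S, ys) \<Rightarrow> Min S # ys) of xs \<Rightarrow> (set xs, tl xs)) = p" if "p \<in> T" for p
    proof -
      obtain S ys where [simp]: "p = (S, ys)" by force
      have S: "S \<subseteq> {..<n}" "card S = k" "set ys = S - {Min S}"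
        using that by (auto simp: T_def permutations_of_set_def)
      have "finite S" "S \<noteq> {}" using S assms fin by auto
      then have "Min S \<in> S" by simp
      then show ?thesis using S by auto
    qed
    show "(case (set xs, tl xs) of (S, ys) \<Rightarrow> Min S # ys) = xs"
      if xs: "xs \<in> {xs \<in> rooted_cycles n. length xs = k}" for xs
    proof -
      obtain x ys where [simp]: "xs = x # ys" using xs by (cases xs) (auto simp: rooted_cycles_def)
      have "Min (set xs) = x" using xs by (intro Min_eqI) (auto simp: rooted_cycles_def)
      then show ?thesis by simp
    qed
  qed
  then have "card {xs \<in> rooted_cycles n. length xs = k} = card T" by (simp add: bij_betw_same_card)
  also have "\<dots> = (\<Sum>S\<in>{S. S \<subseteq> {..<n} \<and> card S = k}. fact (k - 1))"
  proof -
    have "card (permutations_of_set (S - {Min S})) = fact (k - 1)" if "S \<subseteq> {..<n}" "card S = k" for S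
    proof -
      have "finite S" "S \<noteq> {}" using that assms fin by auto
      then show ?thesis using that by (simp add: card_Diff_singleton)
    qed
    then show ?thesis unfolding T_def by (subst card_SigmaI) (auto intro: fin)
  qed
  also have "\<dots> = (n choose k) * fact (k - 1)" by (simp add: n_subsets)
  finally show ?thesis .
qed

lemma finite_rooted_cycles: "finite (rooted_cycles n)"
proof (rule finite_subset)
  show "rooted_cycles n \<subseteq> {xs. set xs \<subseteq> {..<n} \<and> length xs \<le> n}"
    using card_mono[of "{..<n}"] by (force simp: rooted_cycles_def simp flip: distinct_card)
  show "finite {xs. set xs \<subseteq> {..<n} \<and> length xs \<le> n}" by (rule finite_lists_length_le) simp
qed

text \<open>Plain \<open>rev\<close> would move the root to the end; this reversal keeps it in front
  and exchanges the second vertex with the last.\<close>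

definition reverse_cycle :: "'v list \<Rightarrow> 'v list" where
  "reverse_cycle xs = hd xs # rev (tl xs)"

lemma reverse_cycle_rooted:
  assumes "xs \<in> rooted_cycles n"
  shows "reverse_cycle xs \<in> rooted_cycles n" "length (reverse_cycle xs) = length xs"
    and "reverse_cycle xs ! 1 = last xs" "last (reverse_cycle xs) = xs ! 1"
    and "reverse_cycle (reverse_cycle xs) = xs"
proof -
  obtain x ys where [simp]: "xs = x # ys" "ys \<noteq> []"
    using assms by (cases xs; cases "tl xs") (auto simp: rooted_cycles_def)
  show "reverse_cycle xs \<in> rooted_cycles n" "length (reverse_cycle xs) = length xs"
    and "reverse_cycle xs ! 1 = last xs" "last (reverse_cycle xs) = xs ! 1"
    and "reverse_cycle (reverse_cycle xs) = xs"
    using assms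
    by (auto simp: reverse_cycle_def rooted_cycles_def hd_conv_nth last_conv_nth rev_nth last_rev)
qed

lemma rooted_cycle_nth_1_neq_last:
  assumes "xs \<in> rooted_cycles n" "3 \<le> length xs"
  shows "xs ! 1 \<noteq> last xs"
proof -
  have "xs \<noteq> []" "distinct xs" using assms by (auto simp: rooted_cycles_def)
  then show ?thesis using assms by (simp add: last_conv_nth nth_eq_iff_index_eq)
qed

text \<open>\<open>reverse_cycle\<close> is an involution that exchanges the second and the last
  vertex, which differ from length 3 on. It therefore matches the oriented lists with the other
  rooted lists of the same length.\<close>

lemma card_oriented_cycles:
  assumes "3 \<le> k"
  shows "2 * card {xs \<in> oriented_cycles n. length xs = k} = (n choose k) * fact (k - 1)"
proof -
  define A where "A = {xs \<in> oriented_cycles n. length xs = k}"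
  define A' where "A' = {xs \<in> rooted_cycles n. length xs = k \<and> last xs < xs ! 1}"
  have ori: "A = {xs \<in> rooted_cycles n. length xs = k \<and> xs ! 1 < last xs}"
    using assms by (auto simp: A_def oriented_cycles_def)
  have "bij_betw reverse_cycle A A'"
    by (rule bij_betwI[where g = reverse_cycle])
      (auto simp: ori A'_def reverse_cycle_rooted[unfolded One_nat_def])
  then have cA: "card A = card A'" by (rule bij_betw_same_card)
  have "{xs \<in> rooted_cycles n. length xs = k} = A \<union> A'"
    using rooted_cycle_nth_1_neq_last assms by (force simp: ori A'_def)
  moreover have "card (A \<union> A') = card A + card A'"
    by (rule card_Un_disjoint) (auto simp: ori A'_def finite_rooted_cycles)
  ultimately have "2 * card A = card {xs \<in> rooted_cycles n. length xs = k}" using cA by simp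
  then show ?thesis using card_rooted_cycles[of k n] assms by (simp add: A_def)
qed

text \<open>The arcs determine the vertex set and so its minimum, the root; from there the list is
  recovered step by step, as every vertex has a single outgoing arc.\<close>

lemma inj_on_cyc_arcs_rooted: "inj_on cyc_arcs (rooted_cycles n)"
proof (rule inj_onI)
  fix xs ys assume xs: "xs \<in> rooted_cycles n" and ys: "ys \<in> rooted_cycles n" and eq: "cyc_arcs xs = cyc_arcs ys"
  have d: "distinct xs" "distinct ys" using xs ys by (auto simp: rooted_cycles_def)
  have len: "length xs = length ys" using eq d by (metis card_cyc_arcs)
  have st: "set xs = set ys" using eq by (metis fst_cyc_arcs)
  have ne: "xs \<noteq> []" "ys \<noteq> []" using xs ys by (auto simp: rooted_cycles_def)
  have "hd xs = hd ys" using xs ys st ne hd_in_set[of xs] hd_in_set[of ys]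
    by (intro antisym) (auto simp: rooted_cycles_def)
  then have 0: "xs ! 0 = ys ! 0" using ne by (simp add: hd_conv_nth)
  have "i < length xs \<Longrightarrow> xs ! i = ys ! i" for i
  proof (induction i)
    case (Suc i)
    then have "(xs ! i, xs ! Suc i) \<in> cyc_arcs ys" unfolding eq[symmetric]
      by (auto simp: cyc_arcs_conv_nth image_iff intro!: bexI[of _ i])
    then obtain j where "j < length ys" "xs ! i = ys ! j" "xs ! Suc i = ys ! (Suc j mod length ys)"
      by (auto simp: cyc_arcs_conv_nth)
    with Suc d len show ?case by (simp add: nth_eq_iff_index_eq)
  qed (rule 0)
  then show "xs = ys" using len by (intro nth_equalityI) auto
qed

section \<open>Cycles with the orientation forgotten\<close>

definition undirect :: "'v \<times> 'v \<Rightarrow> 'v set" where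
  "undirect = (\<lambda>(u, v). {u, v})"

lemma undirect_simp [simp]: "undirect (u, v) = {u, v}"
  by (simp add: undirect_def)

text \<open>The edges of a cycle at position \<open>i\<close> lead to the successor or the
  predecessor. The latter is described by an equation for \<open>j\<close> instead of
  \<open>i - 1\<close>, so that position 0 is no exception.\<close>

lemma edge_cycleD:
  assumes "{u, v} \<in> undirect ` cyc_arcs ys" "distinct ys" "i < length ys" "u = ys ! i"
  shows "v = ys ! (Suc i mod length ys) \<or> (\<exists>j<length ys. Suc j mod length ys = i \<and> v = ys ! j)"
proof -
  obtain j where j: "j < length ys" "{u, v} = {ys ! j, ys ! (Suc j mod length ys)}"
    using assms(1) by (auto simp: cyc_arcs_conv_nth)
  have "Suc j mod length ys < length ys" using j by (intro mod_less_divisor) linarith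
  then show ?thesis using j assms by (auto simp: doubleton_eq_iff nth_eq_iff_index_eq)
qed

text \<open>Two positions yield the same edge only if each is the successor of the other, which
  happens only on a cycle of length 2.\<close>

lemma inj_on_undirect_cyc_arcs:
  assumes "distinct xs" "3 \<le> length xs"
  shows "inj_on undirect (cyc_arcs xs)"
proof (rule inj_onI)
  let ?k = "length xs"
  fix a b assume "a \<in> cyc_arcs xs" "b \<in> cyc_arcs xs" and eq: "undirect a = undirect b"
  then obtain i j where i: "i < ?k" "a = (xs ! i, xs ! (Suc i mod ?k))"
    and j: "j < ?k" "b = (xs ! j, xs ! (Suc j mod ?k))" by (auto simp: cyc_arcs_conv_nth)
  have lt: "Suc i mod ?k < ?k" "Suc j mod ?k < ?k" using i by (auto intro!: mod_less_divisor)
  have "i = j"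
  proof (rule ccontr)
    assume "i \<noteq> j"
    then have *: "i = Suc j mod ?k" "j = Suc i mod ?k"
      using eq i j lt assms(1) by (auto simp: doubleton_eq_iff nth_eq_iff_index_eq)
    show False
    proof (cases "Suc i = ?k")
      case True
      with * have "j = 0" by simp
      with *(1) True assms(2) show False by simp
    next
      case False
      with * i have "j = Suc i" by simp
      with *(1) show False using False j assms(2) by (cases "Suc j = ?k") simp_all
    qed
  qed
  then show "a = b" using i j by simp
qed

lemma undirect_cyc_arcs_reverse_cycle:
  assumes "xs \<noteq> []"
  shows "undirect ` cyc_arcs (reverse_cycle xs) = undirect ` cyc_arcs xs"
proof -
  have "cyc_arcs (reverse_cycle xs) = cyc_arcs (rotate 1 (reverse_cycle xs))"
    by (simp only: cyc_arcs_rotate)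
  also have "rotate 1 (reverse_cycle xs) = rev xs"
    using assms by (cases xs) (simp_all add: reverse_cycle_def)
  finally show ?thesis
    by (auto simp: cyc_arcs_rev image_iff insert_commute undirect_def split: prod.splits)
qed

lemma inj_on_edges_oriented: "inj_on (\<lambda>xs. undirect ` cyc_arcs xs) (oriented_cycles n)"
proof (rule inj_onI)
  fix xs ys assume xs: "xs \<in> oriented_cycles n" and ys: "ys \<in> oriented_cycles n"
    and eq: "undirect ` cyc_arcs xs = undirect ` cyc_arcs ys"
  have d: "distinct xs" "distinct ys" "3 \<le> length xs" "3 \<le> length ys"
    and m: "\<forall>y\<in>set xs. hd xs \<le> y" "\<forall>y\<in>set ys. hd ys \<le> y"
    and o: "xs ! 1 < last xs" "ys ! 1 < last ys"
    using xs ys by (auto simp: oriented_cycles_def rooted_cycles_def)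
  define k where "k = length xs"
  have len: "length ys = k" unfolding k_def using eq d
    by (metis card_cyc_arcs card_image inj_on_undirect_cyc_arcs)
  have vs: "\<Union> (undirect ` cyc_arcs zs) = set zs" for zs :: "nat list"
  proof
    show "\<Union> (undirect ` cyc_arcs zs) \<subseteq> set zs" by (auto dest: cyc_arcsD)
    show "set zs \<subseteq> \<Union> (undirect ` cyc_arcs zs)"
      unfolding fst_cyc_arcs[symmetric] by (auto simp: undirect_def)
  qed
  have st: "set xs = set ys" using eq vs by metis
  have ne: "xs \<noteq> []" "ys \<noteq> []" using d by auto
  have "hd xs = hd ys" using m st ne hd_in_set[of xs] hd_in_set[of ys] by (intro antisym) auto
  then have 0: "xs ! 0 = ys ! 0" using ne by (simp add: hd_conv_nth)
  have arc: "{zs ! i, zs ! Suc i} \<in> undirect ` cyc_arcs zs" if "Suc i < length zs" for i and zs :: "nat list"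
  proof -
    have "(zs ! i, zs ! Suc i) \<in> cyc_arcs zs"
      using that by (auto simp: cyc_arcs_conv_nth image_iff intro!: bexI[of _ i])
    from imageI[OF this, of undirect] show ?thesis by simp
  qed
  have nbr: "zs' ! 1 = zs ! 1 \<or> zs' ! 1 = last zs"
    if "distinct zs" "length zs = k" "length zs' = k" "zs ! 0 = zs' ! 0" "undirect ` cyc_arcs zs = undirect ` cyc_arcs zs'"
    for zs zs' :: "nat list"
  proof -
    have k: "k \<ge> 3" using d k_def by simp
    have "{zs' ! 0, zs' ! 1} \<in> undirect ` cyc_arcs zs" using arc[of 0 zs'] that k by simp
    from edge_cycleD[OF this, of 0] that k
    consider "zs' ! 1 = zs ! 1" | j where "j < k" "Suc j mod k = 0" "zs' ! 1 = zs ! j" by force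
    then show ?thesis
    proof cases
      case 2
      then have "j = k - 1" using mod_less[of "Suc j" k] by (cases "Suc j < k") auto
      then show ?thesis using 2 that k by (cases "zs = []") (auto simp: last_conv_nth)
    qed simp
  qed
  have "ys ! 1 = xs ! 1 \<or> ys ! 1 = last xs"
    by (rule nbr) (use d len 0 eq in \<open>simp_all add: k_def\<close>)
  moreover have "xs ! 1 = ys ! 1 \<or> xs ! 1 = last ys"
    by (rule nbr) (use d len 0 eq in \<open>simp_all add: k_def\<close>)
  \<comment> \<open>If both lists disagreed here, then
    \<open>xs ! 1 < last xs = ys ! 1 < last ys = xs ! 1\<close>, a contradiction. This is where the
    choice of orientation enters.\<close>
  ultimately have 1: "xs ! 1 = ys ! 1"
    using o by (elim disjE) linarith+
  have "Suc i < k \<Longrightarrow> xs ! i = ys ! i \<and> xs ! Suc i = ys ! Suc i" for i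
  proof (induction i)
    case (Suc i)
    then have IH: "xs ! i = ys ! i" "xs ! Suc i = ys ! Suc i" and i: "Suc (Suc i) < k" by auto
    have "{xs ! Suc i, xs ! Suc (Suc i)} \<in> undirect ` cyc_arcs ys"
      using arc[of "Suc i" xs] i eq by (simp add: k_def)
    from edge_cycleD[OF this d(2), of "Suc i"] IH i len
    consider "xs ! Suc (Suc i) = ys ! Suc (Suc i)"
      | j where "j < k" "Suc j mod k = Suc i" "xs ! Suc (Suc i) = ys ! j" by force
    then show ?case
    proof cases
      case 2
      \<comment> \<open>The predecessor in \<open>ys\<close> is the vertex just left, and
        \<open>xs\<close> cannot turn back to it because its entries are distinct.\<close>
      then have "j = i" by (cases "Suc j = k") auto
      then have "xs ! Suc (Suc i) = xs ! i" using 2 IH by simp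
      then show ?thesis using d(1) i by (simp add: nth_eq_iff_index_eq k_def)
    qed (use IH in simp)
  qed (use 0 1 in simp)
  then have "xs ! i = ys ! i" if "i < k" for i
    using that d(3) by (cases i) (auto simp: k_def 0)
  then show "xs = ys" using len by (intro nth_equalityI) (auto simp: k_def)
qed

section \<open>Closed arc walks of the complete graph and vertex lists\<close>

lemma cyc_arcs_subset:
  assumes "xs \<in> rooted_cycles n"
  shows "cyc_arcs xs \<subseteq> arcs (directed_complete_graph n)"
proof
  fix a assume a: "a \<in> cyc_arcs xs"
  obtain u v where [simp]: "a = (u, v)" by force
  have "u \<in> set xs" "v \<in> set xs" using a cyc_arcsD[of u v xs] by auto
  moreover have "u \<noteq> v" using assms a cyc_arcs_irrefl[of xs u v] by (auto simp: rooted_cycles_def)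
  ultimately show "a \<in> arcs (directed_complete_graph n)"
    using assms by (auto simp: rooted_cycles_def directed_complete_graph_def)
qed

text \<open>The end vertex is left free for the induction; with \<open>v = hd xs\<close> the second
  list becomes \<open>rotate1 xs\<close> and the walk closes up.\<close>

lemma cas_zip_rotate1:
  "xs \<noteq> [] \<Longrightarrow> pre_digraph.cas (directed_complete_graph n) (hd xs) (zip xs (tl xs @ [v])) v"
proof (induction xs)
  case (Cons x ys)
  then show ?case
    by (cases ys) (simp_all add: pre_digraph.cas.simps directed_complete_graph_def)
qed simp

lemma cas_map_snd:
  "pre_digraph.cas (directed_complete_graph n) u p v \<Longrightarrow> p \<noteq> [] \<Longrightarrow>
    map snd p = tl (map fst p) @ [v] \<and> fst (hd p) = u"
proof (induction p arbitrary: u)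
  case (Cons a p)
  then show ?case
    by (cases p) (auto simp: pre_digraph.cas.simps directed_complete_graph_def)
qed simp

lemma rooted_cycle_imp_directed_cycle:
  assumes "xs \<in> rooted_cycles n"
  shows "zip xs (rotate1 xs) \<in> directed_cycles n"
proof -
  let ?G = "directed_complete_graph n" and ?p = "zip xs (rotate1 xs)"
  have xs: "distinct xs" "set xs \<subseteq> {..<n}" "xs \<noteq> []" using assms by (auto simp: rooted_cycles_def)
  then have "hd xs < n" by (cases xs) auto
  moreover have "set ?p \<subseteq> arcs ?G" using cyc_arcs_subset[OF assms] by (simp add: cyc_arcs_def)
  moreover have "pre_digraph.cas ?G (hd xs) ?p (hd xs)"
    using cas_zip_rotate1[OF xs(3), of n "hd xs"] xs(3) by (simp add: rotate1_hd_tl)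
  ultimately have "pre_digraph.awalk ?G (hd xs) ?p (hd xs)"
    by (simp add: pre_digraph.awalk_def directed_complete_graph_def)
  moreover have "?p \<noteq> []" using xs(3) by (cases xs) auto
  \<comment> \<open>A closed walk lists its base point twice, so distinctness is demanded after
    dropping the first vertex; what remains is \<open>rotate1 xs\<close>.\<close>
  moreover have "distinct (tl (pre_digraph.awalk_verts ?G (hd xs) ?p))"
  proof -
    have "tail ?G = fst" "head ?G = snd" by (simp_all add: directed_complete_graph_def)
    then have "tl (pre_digraph.awalk_verts ?G (hd xs) ?p) = tl xs @ [last (map snd ?p)]"
      using \<open>?p \<noteq> []\<close> xs(3) by (simp add: pre_digraph.awalk_verts_conv last_map del: map_snd_zip)
    also have "last (map snd ?p) = hd xs" using xs(3) by (simp add: rotate1_hd_tl)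
    also have "tl xs @ [hd xs] = rotate1 xs" using xs(3) by (simp add: rotate1_hd_tl)
    finally show ?thesis using xs(1) by simp
  qed
  ultimately show ?thesis by (auto simp: directed_cycles_def pre_digraph.cycle_def)
qed

text \<open>The list of tails, rotated so that its least vertex comes first, is the required list.
  Distinctness of \<open>p\<close> is recorded as well, for
  \<open>mean_weight_le_iff\<close>.\<close>

lemma directed_cycle_imp_rooted_cycle:
  assumes "p \<in> directed_cycles n"
  obtains xs where "xs \<in> rooted_cycles n" "cyc_arcs xs = set p" "length xs = length p"
    and "distinct p" "p \<noteq> []"
proof -
  let ?G = "directed_complete_graph n"
  have G: "tail ?G = fst" "head ?G = snd" by (simp_all add: directed_complete_graph_def)
  obtain u where u: "pre_digraph.awalk ?G u p u" "distinct (tl (pre_digraph.awalk_verts ?G u p))" "p \<noteq> []"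
    using assms by (auto simp: directed_cycles_def pre_digraph.cycle_def)
  then have arcs: "set p \<subseteq> arcs ?G" and cas: "pre_digraph.cas ?G u p u"
    by (auto simp: pre_digraph.awalk_def)
  define ys where "ys = map fst p"
  have ys: "ys \<noteq> []" "set ys \<subseteq> {..<n}" using u(3) arcs by (auto simp: ys_def directed_complete_graph_def)
  have snd: "map snd p = tl ys @ [u]" "u = hd ys"
    using cas_map_snd[OF cas u(3)] u(3) by (auto simp: ys_def hd_map)
  then have rot: "map snd p = rotate1 ys" using ys by (simp add: rotate1_hd_tl)
  have "p = zip ys (map snd p)" by (simp add: ys_def zip_map_fst_snd)
  then have p: "p = zip ys (rotate1 ys)" by (simp only: rot)
  have "tl (pre_digraph.awalk_verts ?G u p) = tl ys @ [last (map snd p)]"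
    using u(3) ys(1) by (simp add: pre_digraph.awalk_verts_conv G last_map ys_def)
  also have "\<dots> = rotate1 ys" using snd ys by (simp add: rotate1_hd_tl)
  finally have d: "distinct ys" using u(2) by simp
  have "length ys \<noteq> 1"
  proof
    assume "length ys = 1"
    then obtain y where "ys = [y]" by (auto simp: length_Suc_conv)
    then have "p = [(y, y)]" using p by simp
    then show False using arcs by (simp add: directed_complete_graph_def)
  qed
  moreover have "length ys \<noteq> 0" using ys by simp
  ultimately have l: "2 \<le> length ys" by linarith
  obtain i where i: "hd (rotate i ys) = Min (set ys)"
    using rotate_to_hd[of "Min (set ys)" ys] ys by auto
  show ?thesis
  proof (rule that)
    show "rotate i ys \<in> rooted_cycles n" using i d ys l by (simp add: rooted_cycles_def)
    show "cyc_arcs (rotate i ys) = set p" unfolding cyc_arcs_rotate by (simp add: p cyc_arcs_def)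
    show "length (rotate i ys) = length p" by (simp add: ys_def)
    show "distinct p" unfolding p using d by (rule distinct_zipI1)
  qed (rule u(3))
qed

text \<open>A cycle repeats no edge, so the sum along the list is a sum over the edge set, the form
  to which independence applies.\<close>

lemma mean_weight_le_iff:
  assumes "distinct p" "p \<noteq> []"
  shows "mean_weight w p \<le> r \<longleftrightarrow> (\<Sum>e\<in>set p. w e) \<le> real (length p) * r"
  using assms by (simp add: mean_weight_def sum_list_distinct_conv_sum_set divide_le_eq mult.commute)

lemma light_directed_cycle_iff:
  "(\<exists>p\<in>directed_cycles n. mean_weight w p \<le> r) \<longleftrightarrow>
    (\<exists>xs\<in>rooted_cycles n. (\<Sum>e\<in>cyc_arcs xs. w e) \<le> real (length xs) * r)"
proof safe
  fix p assume p: "p \<in> directed_cycles n" "mean_weight w p \<le> r"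
  from directed_cycle_imp_rooted_cycle[OF p(1)]
  obtain xs where xs: "xs \<in> rooted_cycles n" "cyc_arcs xs = set p" "length xs = length p"
    and "distinct p" "p \<noteq> []" .
  then show "\<exists>xs\<in>rooted_cycles n. (\<Sum>e\<in>cyc_arcs xs. w e) \<le> real (length xs) * r"
    using p(2) by (intro bexI[OF _ xs(1)]) (simp add: mean_weight_le_iff)
next
  fix xs assume xs: "xs \<in> rooted_cycles n" "(\<Sum>e\<in>cyc_arcs xs. w e) \<le> real (length xs) * r"
  then have "distinct (zip xs (rotate1 xs))" "zip xs (rotate1 xs) \<noteq> []"
    by (auto simp: rooted_cycles_def intro: distinct_zipI1)
  then have "mean_weight w (zip xs (rotate1 xs)) \<le> r"
    using xs(2) by (simp add: mean_weight_le_iff flip: cyc_arcs_def)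
  then show "\<exists>p\<in>directed_cycles n. mean_weight w p \<le> r"
    using rooted_cycle_imp_directed_cycle[OF xs(1)] by blast
qed

lemma light_undirected_cycle_iff:
  "(\<exists>q\<in>undirected_cycles n. mean_weight w q \<le> r) \<longleftrightarrow>
    (\<exists>xs\<in>oriented_cycles n. (\<Sum>e\<in>undirect ` cyc_arcs xs. w e) \<le> real (length xs) * r)"
proof safe
  fix q assume "q \<in> undirected_cycles n" and le: "mean_weight w q \<le> r"
  then obtain p where p: "p \<in> directed_cycles n" "3 \<le> length p" "q = map undirect p"
    by (auto simp: undirected_cycles_def undirect_def)
  from directed_cycle_imp_rooted_cycle[OF p(1)]
  obtain xs where xs: "xs \<in> rooted_cycles n" "cyc_arcs xs = set p" "length xs = length p"
    and dp: "distinct p" "p \<noteq> []" .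
  have xs': "distinct xs" "3 \<le> length xs" using xs p by (auto simp: rooted_cycles_def)
  have "distinct q"
    using dp inj_on_undirect_cyc_arcs[OF xs'] xs(2) by (simp add: p(3) distinct_map)
  then have le': "(\<Sum>e\<in>undirect ` cyc_arcs xs. w e) \<le> real (length xs) * r"
    using le dp xs by (simp add: mean_weight_le_iff p(3))
  show "\<exists>xs\<in>oriented_cycles n. (\<Sum>e\<in>undirect ` cyc_arcs xs. w e) \<le> real (length xs) * r"
  \<comment> \<open>A list with the wrong orientation is replaced by its reversal, which has the
    same edges and the same length.\<close>
  proof (cases "xs ! 1 < last xs")
    case True
    then have "xs \<in> oriented_cycles n" using xs xs' by (simp add: oriented_cycles_def)
    then show ?thesis using le' by blast
  next
    case False
    then have "last xs < xs ! 1"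
      using rooted_cycle_nth_1_neq_last[OF xs(1) xs'(2)] by linarith
    then have "reverse_cycle xs \<in> oriented_cycles n"
      using reverse_cycle_rooted[OF xs(1)] xs'(2) by (simp add: oriented_cycles_def)
    moreover have "xs \<noteq> []" using xs' by auto
    ultimately show ?thesis
      using le' reverse_cycle_rooted(2)[OF xs(1)] by (auto simp: undirect_cyc_arcs_reverse_cycle intro: bexI[of _ "reverse_cycle xs"])
  qed
next
  fix xs assume xs: "xs \<in> oriented_cycles n"
    and le: "(\<Sum>e\<in>undirect ` cyc_arcs xs. w e) \<le> real (length xs) * r"
  let ?p = "zip xs (rotate1 xs)"
  have xs': "xs \<in> rooted_cycles n" "distinct xs" "3 \<le> length xs"
    using xs by (auto simp: oriented_cycles_def rooted_cycles_def)
  have "distinct ?p" using xs'(2) by (rule distinct_zipI1)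
  then have "distinct (map undirect ?p)"
    using inj_on_undirect_cyc_arcs[OF xs'(2,3)] by (simp add: distinct_map cyc_arcs_def)
  moreover have "map undirect ?p \<noteq> []" using xs' by auto
  ultimately have "mean_weight w (map undirect ?p) \<le> r"
    using le by (simp add: mean_weight_le_iff flip: cyc_arcs_def)
  moreover have "map undirect ?p \<in> undirected_cycles n"
    using rooted_cycle_imp_directed_cycle[OF xs'(1)] xs'(3)
    unfolding undirected_cycles_def undirect_def by (auto intro!: exI[of _ ?p])
  ultimately show "\<exists>q\<in>undirected_cycles n. mean_weight w q \<le> r" by blast
qed

section \<open>Counting light cycles\<close>

text \<open>Each vertex of \<open>ys\<close> outside \<open>xs\<close> has an outgoing edge not in \<open>xs\<close>, and so does some vertex
  where \<open>ys\<close> leaves \<open>xs\<close>. Hence light cycles that meet are asymptotically negligible.\<close>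

lemma card_edges_union_bound:
  fixes f :: "'v \<times> 'v \<Rightarrow> 'e"
  assumes f: "\<And>u v u' v'. f (u, v) = f (u', v') \<Longrightarrow> {u, v} = {u', v'}"
    and d: "distinct xs" "distinct ys"
    and inj: "inj_on f (cyc_arcs xs)" "inj_on f (cyc_arcs ys)"
    and ne: "f ` cyc_arcs xs \<noteq> f ` cyc_arcs ys"
    and share: "set xs \<inter> set ys \<noteq> {}"
  shows "card (set xs \<union> set ys) + 1 \<le> card (f ` cyc_arcs xs \<union> f ` cyc_arcs ys)"
proof -
  have main: "card (set xs \<union> set ys) + 1 \<le> card (f ` cyc_arcs xs \<union> f ` cyc_arcs ys)"
    if d: "distinct xs" "distinct ys"
    and inj: "inj_on f (cyc_arcs xs)" "inj_on f (cyc_arcs ys)"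
    and ne: "f ` cyc_arcs xs \<noteq> f ` cyc_arcs ys"
    and share: "set xs \<inter> set ys \<noteq> {}" and le: "length xs \<le> length ys" for xs ys
  proof -
    let ?X = "f ` cyc_arcs xs" and ?Y = "f ` cyc_arcs ys"
    have cX: "card ?X = card (set xs)" and cY: "card ?Y = length ys"
      using d inj by (simp_all add: card_image card_cyc_arcs distinct_card)
    have ends: "u \<in> set xs \<and> v \<in> set xs" if "f (u, v) \<in> ?X" for u v
    proof -
      from that obtain u' v' where *: "(u', v') \<in> cyc_arcs xs" "f (u, v) = f (u', v')" by auto
      then show ?thesis using f[OF *(2)] cyc_arcsD[OF *(1)] by (metis insert_iff singletonD)
    qed
    \<comment> \<open>Otherwise \<open>ys\<close>, once in \<open>set xs\<close>, could never leave
      it and would use edges of \<open>xs\<close> only. As \<open>ys\<close> is at least as long,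
      the edge sets would coincide.\<close>
    have "\<exists>u v. (u, v) \<in> cyc_arcs ys \<and> u \<in> set xs \<and> f (u, v) \<notin> ?X"
    proof (rule ccontr)
      assume *: "\<not> ?thesis"
      obtain x where x: "x \<in> set ys" "x \<in> set xs" using share by auto
      have sub: "set ys \<subseteq> set xs"
        by (rule cyc_arcs_closed[OF x]) (use * ends in blast)
      have "?Y \<subseteq> ?X"
      proof
        fix e assume "e \<in> ?Y"
        then obtain u v where "(u, v) \<in> cyc_arcs ys" "e = f (u, v)" by auto
        moreover from this have "u \<in> set ys" by (auto dest: cyc_arcsD)
        ultimately show "e \<in> ?X" using * sub by blast
      qed
      moreover have "card ?X \<le> card ?Y" using cX cY le d by (simp add: distinct_card)
      ultimately have "?Y = ?X" by (intro card_seteq) auto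
      with ne show False by simp
    qed
    then obtain u0 v0 where uv: "(u0, v0) \<in> cyc_arcs ys" "u0 \<in> set xs" "f (u0, v0) \<notin> ?X" by blast
    \<comment> \<open>Arcs of a cycle are counted by their first vertices, which determine them;
      \<open>u0\<close> lies in \<open>set xs\<close>, so it adds 1 to the number of new
      vertices.\<close>
    define Z where "Z = insert (u0, v0) {a \<in> cyc_arcs ys. fst a \<notin> set xs}"
    have Z: "Z \<subseteq> cyc_arcs ys" using uv by (auto simp: Z_def)
    have "fst ` Z = insert u0 (set ys - set xs)"
      using uv(2) imageI[OF uv(1), of fst] unfolding Z_def fst_cyc_arcs[of ys, symmetric] by auto
    moreover have "card (fst ` Z) = card Z"
      using inj_on_subset[OF inj_on_fst_cyc_arcs[OF d(2)] Z] by (rule card_image)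
    ultimately have cZ: "card Z = card (set ys - set xs) + 1" using uv by simp
    have fZ: "card (f ` Z) = card Z" using inj_on_subset[OF inj(2) Z] by (rule card_image)
    have "f a \<notin> ?X" if "a \<in> Z" for a
      using that uv(3) ends[of "fst a" "snd a"] unfolding Z_def prod.collapse by blast
    then have disj: "f ` Z \<inter> ?X = {}" by blast
    have "finite Z" using finite_subset[OF Z] by simp
    then have "card (?X \<union> f ` Z) = card ?X + card (f ` Z)"
      using disj by (intro card_Un_disjoint) auto
    moreover have "card (?X \<union> f ` Z) \<le> card (?X \<union> ?Y)" using Z by (intro card_mono) auto
    moreover have "card (set xs \<union> set ys) = card (set xs) + card (set ys - set xs)"
      by (metis Un_Diff_cancel card_Un_disjoint Diff_disjoint List.finite_set finite_Diff)
    ultimately show ?thesis using cX fZ cZ by linarith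
  qed
  show ?thesis
  proof (cases "length xs \<le> length ys")
    case False
    then show ?thesis using main[OF d(2,1) inj(2,1) ne[symmetric]] share by (simp add: Un_commute Int_commute)
  qed (use main assms in blast)
qed

text \<open>Group the pairs by the union of their vertex sets. There are at most n^v unions of size
  v, each arising from a number of pairs bounded in terms of \<open>K\<close>, and each pair
  contributes n^-(v+1); so every v up to \<open>2 * K\<close> contributes O(1 / n).\<close>

lemma sum_list_pairs_inverse_power_bound:
  fixes C :: "nat \<Rightarrow> nat list set"
  assumes C: "\<And>n xs. xs \<in> C n \<Longrightarrow> set xs \<subseteq> {..<n} \<and> length xs \<le> K"
  shows "\<exists>Q\<ge>0. \<forall>n\<ge>1. (\<Sum>(xs, ys)\<in>C n \<times> C n. 1 / real n ^ (card (set xs \<union> set ys) + 1)) \<le> Q / real n"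
proof (intro exI conjI allI impI)
  \<comment> \<open>Bounds the number of lists of length at most \<open>K\<close> over an alphabet
    of at most \<open>2 * K\<close> vertices.\<close>
  define q where "q = (\<Sum>i\<le>K. (2 * K) ^ i)"
  show "0 \<le> real ((2 * K + 1) * q^2)" by simp
  fix n :: nat assume n: "n \<ge> 1"
  define g where "g = (\<lambda>(xs, ys). set xs \<union> set ys :: nat set)"
  define T where "T = {S. S \<subseteq> {..<n} \<and> card S \<le> 2 * K}"
  have "finite {xs. set xs \<subseteq> {..<n} \<and> length xs \<le> K}" by (rule finite_lists_length_le) simp
  then have finC: "finite (C n)" by (rule rev_finite_subset) (use C in blast)
  have finT: "finite T" unfolding T_def by (rule finite_subset[of _ "Pow {..<n}"]) auto
  have gT: "g p \<in> T" if "p \<in> C n \<times> C n" for p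
  proof -
    from that obtain xs ys where p: "p = (xs, ys)" "xs \<in> C n" "ys \<in> C n" by auto
    have "card (set xs \<union> set ys) \<le> card (set xs) + card (set ys)" by (rule card_Un_le)
    also have "\<dots> \<le> length xs + length ys" by (intro add_mono card_length)
    finally show ?thesis using C[of xs n] C[of ys n] p by (auto simp: T_def g_def)
  qed
  have fib: "card {p \<in> C n \<times> C n. g p = S} \<le> q^2" if S: "S \<in> T" for S
  proof -
    have finS: "finite S" using S by (auto simp: T_def intro: finite_subset)
    define L where "L = {xs. set xs \<subseteq> S \<and> length xs \<le> K}"
    have finL: "finite L" unfolding L_def using finS by (rule finite_lists_length_le)
    have "card L = (\<Sum>i\<le>K. card S ^ i)" unfolding L_def using finS by (rule card_lists_length_le)
    also have "\<dots> \<le> q" unfolding q_def using S by (intro sum_mono power_mono) (auto simp: T_def)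
    finally have L: "card L \<le> q" .
    have "{p \<in> C n \<times> C n. g p = S} \<subseteq> L \<times> L" using C by (auto simp: g_def L_def)
    then have "card {p \<in> C n \<times> C n. g p = S} \<le> card (L \<times> L)" using finL by (intro card_mono) auto
    also have "\<dots> \<le> q^2" using L by (simp add: card_cartesian_product power2_eq_square mult_mono)
    finally show ?thesis .
  qed
  have "(\<Sum>(xs, ys)\<in>C n \<times> C n. 1 / real n ^ (card (set xs \<union> set ys) + 1))
     = (\<Sum>p\<in>C n \<times> C n. 1 / real n ^ (card (g p) + 1))"
    by (simp add: g_def case_prod_unfold)
  also have "\<dots> = (\<Sum>S\<in>T. \<Sum>p\<in>{p \<in> C n \<times> C n. g p = S}. 1 / real n ^ (card (g p) + 1))"
    using finC finT gT by (intro sum.group[symmetric]) auto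
  also have "\<dots> = (\<Sum>S\<in>T. real (card {p \<in> C n \<times> C n. g p = S}) * (1 / real n ^ (card S + 1)))"
    by (intro sum.cong) auto
  also have "\<dots> \<le> (\<Sum>S\<in>T. real (q^2) * (1 / real n ^ (card S + 1)))"
    using fib by (intro sum_mono mult_right_mono) (simp_all del: of_nat_power)
  also have "\<dots> = (\<Sum>v\<le>2 * K. \<Sum>S\<in>{S\<in>T. card S = v}. real (q^2) * (1 / real n ^ (card S + 1)))"
    using finT by (intro sum.group[symmetric]) (auto simp: T_def)
  also have "\<dots> = (\<Sum>v\<le>2 * K. real (n choose v) * (real (q^2) * (1 / real n ^ (v + 1))))"
  proof (intro sum.cong refl)
    fix v assume "v \<in> {..2 * K}"
    then have "{S\<in>T. card S = v} = {S. S \<subseteq> {..<n} \<and> card S = v}" by (auto simp: T_def)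
    then have "card {S\<in>T. card S = v} = n choose v" by (simp add: n_subsets)
    then show "(\<Sum>S\<in>{S\<in>T. card S = v}. real (q^2) * (1 / real n ^ (card S + 1)))
        = real (n choose v) * (real (q^2) * (1 / real n ^ (v + 1)))"
      by simp
  qed
  also have "\<dots> \<le> (\<Sum>v\<le>2 * K. real n ^ v * (real (q^2) * (1 / real n ^ (v + 1))))"
  proof (intro sum_mono mult_right_mono)
    fix v
    have "n choose v \<le> (n choose v) * fact v" by simp
    also have "\<dots> \<le> n ^ v" by (rule binomial_fact_pow)
    finally show "real (n choose v) \<le> real n ^ v" by (simp flip: of_nat_power)
  qed simp
  also have "\<dots> = (\<Sum>v\<le>2 * K. real (q^2) / real n)" using n by (simp add: field_simps)
  also have "\<dots> = real ((2 * K + 1) * q^2) / real n" by (simp add: distrib_right)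
  finally show "(\<Sum>(xs, ys)\<in>C n \<times> C n. 1 / real n ^ (card (set xs \<union> set ys) + 1)) \<le> real ((2 * K + 1) * q^2) / real n" .
qed

text \<open>The common setting of both models: \<open>f\<close> maps an arc to the edge carrying its weight, \<open>C n\<close>
  contains one vertex list per cycle, and \<open>1 / \<kappa>\<close> is the number of orientations identified
  with one another.\<close>

locale cycle_family =
  fixes f :: "nat \<times> nat \<Rightarrow> 'e" and C :: "nat \<Rightarrow> nat list set" and \<kappa> :: real and m :: nat
  assumes C: "C n \<subseteq> rooted_cycles n"
    and ends: "f (u, v) = f (u', v') \<Longrightarrow> {u, v} = {u', v'}"
    and inj_arcs: "xs \<in> C n \<Longrightarrow> inj_on f (cyc_arcs xs)"
    and inj: "inj_on (\<lambda>xs. f ` cyc_arcs xs) (C n)"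
    and \<kappa>: "0 < \<kappa>"
    and m: "1 \<le> m"
    and len: "xs \<in> C n \<Longrightarrow> m \<le> length xs"
    and card_C: "m \<le> k \<Longrightarrow> real (card {xs \<in> C n. length xs = k}) = \<kappa> * (real (n choose k) * fact (k - 1))"
begin

abbreviation edges :: "nat list \<Rightarrow> 'e set" where
  "edges xs \<equiv> f ` cyc_arcs xs"

definition limit_mean :: "real \<Rightarrow> nat \<Rightarrow> real" where
  "limit_mean c K = \<kappa> * (\<Sum>k\<in>{m..K}. tree_term c k)"

context
  fixes M :: "nat \<Rightarrow> 'a measure" and w :: "nat \<Rightarrow> 'e \<Rightarrow> 'a \<Rightarrow> real" and c :: real
  assumes iid: "\<And>n. iid_exponential (M n) (f ` arcs (directed_complete_graph n)) (w n)"
    and c: "0 \<le> c"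
begin

definition light :: "nat \<Rightarrow> nat list \<Rightarrow> 'a set" where
  "light n xs = {\<omega> \<in> space (M n). (\<Sum>e\<in>edges xs. w n e \<omega>) \<le> real (length xs) * (c / real n)}"

lemma distinctC: "xs \<in> C n \<Longrightarrow> distinct xs"
  using C by (auto simp: rooted_cycles_def)

lemma card_edges: "xs \<in> C n \<Longrightarrow> card (edges xs) = length xs"
  by (simp add: card_image inj_arcs card_cyc_arcs distinctC)

lemma edges_subset: "xs \<in> C n \<Longrightarrow> edges xs \<subseteq> f ` arcs (directed_complete_graph n)"
  using C cyc_arcs_subset by blast

text \<open>An edge determines its endpoints. Hence vertex-disjoint cycles have independent weights,
  and meeting in a vertex can serve as the dependency relation.\<close>

lemma edges_disjoint:
  assumes "set xs \<inter> set ys = {}"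
  shows "edges xs \<inter> edges ys = {}"
proof (rule ccontr)
  assume "\<not> ?thesis"
  then obtain u v u' v' where *: "(u, v) \<in> cyc_arcs xs" "(u', v') \<in> cyc_arcs ys" "f (u, v) = f (u', v')"
    by auto
  have "u \<in> {u', v'}" using ends[OF *(3)] by auto
  then show False using cyc_arcsD[OF *(1)] cyc_arcsD[OF *(2)] assms by auto
qed

lemma finiteC: "finite (C n)"
  using C finite_rooted_cycles finite_subset by blast

lemma light_events: "xs \<in> C n \<Longrightarrow> light n xs \<in> sets (M n)"
  unfolding light_def by (rule iid_exponential_sum_sets[OF iid edges_subset])

lemma prob_light:
  assumes "xs \<in> C n"
  shows "measure (M n) (light n xs) = erlang_CDF (length xs - 1) 1 (real (length xs) * (c / real n))"
  unfolding light_def card_edges[OF assms, symmetric]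
proof (rule iid_exponential_sum_le[OF iid])
  show "edges xs \<subseteq> f ` arcs (directed_complete_graph n)" by (rule edges_subset[OF assms])
  show "edges xs \<noteq> {}" using card_edges[OF assms] len[OF assms] m by auto
qed (use c in auto)

section \<open>Expected numbers of light cycles\<close>

lemma sum_prob_light:
  assumes "m \<le> k"
  shows "(\<Sum>xs\<in>{xs\<in>C n. length xs = k}. measure (M n) (light n xs)) =
    \<kappa> * (real (n choose k) * fact (k - 1)) * erlang_CDF (k - 1) 1 (real k * (c / real n))"
proof -
  have "(\<Sum>xs\<in>{xs\<in>C n. length xs = k}. measure (M n) (light n xs)) =
     (\<Sum>xs\<in>{xs\<in>C n. length xs = k}. erlang_CDF (k - 1) 1 (real k * (c / real n)))"
    by (intro sum.cong) (auto simp: prob_light)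
  then show ?thesis by (simp add: card_C[OF assms])
qed

text \<open>The number of cycles times the leading term of the probability. The falling factorial
  quotient is split off because it is at most 1 and tends to 1, which serves both the uniform bound
  and the limit.\<close>

lemma power_eq_tree_term:
  assumes "1 \<le> k" "n \<ge> 1"
  shows "\<kappa> * (real (n choose k) * fact (k - 1)) * ((real k * (c / real n)) ^ k / fact k)
    = \<kappa> * (real (n choose k) * fact k / real n ^ k) * tree_term c k"
proof -
  obtain j where k: "k = Suc j" using assms by (cases k) auto
  show ?thesis using assms(2)
    by (simp add: k tree_term_def power_mult_distrib power_divide divide_simps del: of_nat_Suc)
qed

text \<open>Unlike the limit, this bound is uniform in \<open>n\<close>, as the sum over all long
  cycles requires.\<close>

lemma sum_prob_light_le:
  assumes "m \<le> k" "n \<ge> 1"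
  shows "(\<Sum>xs\<in>{xs\<in>C n. length xs = k}. measure (M n) (light n xs)) \<le> \<kappa> * tree_term c k"
proof -
  have "(\<Sum>xs\<in>{xs\<in>C n. length xs = k}. measure (M n) (light n xs)) \<le>
     \<kappa> * (real (n choose k) * fact (k - 1)) * ((real k * (c / real n)) ^ k / fact k)"
    unfolding sum_prob_light[OF assms(1)] using \<kappa> c assms m
    by (intro mult_left_mono erlang_CDF_bounds) auto
  also have "\<dots> = \<kappa> * (real (n choose k) * fact k / real n ^ k) * tree_term c k"
    using assms m by (intro power_eq_tree_term) auto
  also have "\<dots> \<le> \<kappa> * 1 * tree_term c k"
  proof (intro mult_right_mono mult_left_mono tree_term_nonneg c)
    have "real ((n choose k) * fact k) \<le> real (n ^ k)" by (intro of_nat_mono binomial_fact_pow)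
    then show "real (n choose k) * fact k / real n ^ k \<le> 1" using assms(2) by simp
  qed (use \<kappa> in auto)
  finally show ?thesis by simp
qed

lemma sum_prob_light_tendsto:
  assumes "m \<le> k"
  shows "(\<lambda>n. \<Sum>xs\<in>{xs\<in>C n. length xs = k}. measure (M n) (light n xs)) \<longlonglongrightarrow> \<kappa> * tree_term c k"
proof (rule tendsto_sandwich)
  define h where "h n = \<kappa> * (real (n choose k) * fact k / real n ^ k) * tree_term c k" for n
  have h: "h \<longlonglongrightarrow> \<kappa> * 1 * tree_term c k"
    unfolding h_def by (intro tendsto_intros binomial_fact_asymp)
  have "(\<lambda>n. exp (- 2 * (real k * (c / real n))) * h n) \<longlonglongrightarrow> exp (- 2 * (real k * 0)) * (\<kappa> * 1 * tree_term c k)"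
    by (intro tendsto_intros h lim_const_over_n)
  then show "(\<lambda>n. exp (- 2 * (real k * (c / real n))) * h n) \<longlonglongrightarrow> \<kappa> * tree_term c k" by simp
  show "\<forall>\<^sub>F n in sequentially. exp (- 2 * (real k * (c / real n))) * h n \<le>
      (\<Sum>xs\<in>{xs\<in>C n. length xs = k}. measure (M n) (light n xs))"
    using eventually_ge_at_top[of 1]
  proof eventually_elim
    case (elim n)
    have "exp (- 2 * (real k * (c / real n))) * h n =
      \<kappa> * (real (n choose k) * fact (k - 1)) * (exp (- 2 * (real k * (c / real n))) * (real k * (c / real n)) ^ k / fact k)"
      unfolding h_def using assms m elim
      by (subst power_eq_tree_term[symmetric]) (simp_all add: mult_ac)
    also have "\<dots> \<le> (\<Sum>xs\<in>{xs\<in>C n. length xs = k}. measure (M n) (light n xs))"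
      unfolding sum_prob_light[OF assms(1)] using \<kappa> c assms m
      by (intro mult_left_mono erlang_CDF_bounds) auto
    finally show ?case .
  qed
  show "\<forall>\<^sub>F n in sequentially.
      (\<Sum>xs\<in>{xs\<in>C n. length xs = k}. measure (M n) (light n xs)) \<le> \<kappa> * tree_term c k"
    using eventually_ge_at_top[of 1] by eventually_elim (rule sum_prob_light_le[OF assms])
qed simp

text \<open>Every edge forced to be light costs a factor of order 1 / n, so the exponents are
  numbers of edges. In the product the lengths are added, which counts a shared vertex twice; for
  the joint event \<open>card_edges_union_bound\<close> supplies the extra factor.\<close>

lemma prob_two_light_le:
  assumes xs: "xs \<in> C n" "length xs \<le> K" and ys: "ys \<in> C n" "length ys \<le> K"
    and share: "set xs \<inter> set ys \<noteq> {}" and n: "n \<ge> 1"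
  defines "d \<equiv> max 1 (real K * c) ^ (2 * K) / real n ^ (card (set xs \<union> set ys) + 1)"
  shows "measure (M n) (light n xs) * measure (M n) (light n ys) \<le> d"
    and "xs \<noteq> ys \<Longrightarrow> measure (M n) (light n xs \<inter> light n ys) \<le> d"
proof -
  interpret prob_space "M n" using iid[of n] by (simp add: iid_exponential_def)
  \<comment> \<open>The maximum with 1 makes powers of \<open>D\<close> increase with the exponent,
    so that \<open>D ^ (2 * K)\<close> dominates all that occur.\<close>
  define D where "D = max 1 (real K * c)"
  define t where "t = D / real n"
  have t: "real (length zs) * (c / real n) \<le> t" if "length zs \<le> K" for zs :: "nat list"
  proof -
    have "real (length zs) * c \<le> real K * c" using that c by (intro mult_right_mono) auto
    also have "\<dots> \<le> D" by (simp add: D_def)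
    finally show ?thesis by (simp add: t_def divide_right_mono)
  qed
  have t0: "0 \<le> t" by (simp add: t_def D_def)
  have pw: "t ^ j \<le> d" if "card (set xs \<union> set ys) + 1 \<le> j" "j \<le> 2 * K" for j
  proof -
    have "t ^ j = D ^ j / real n ^ j" by (simp add: t_def power_divide)
    also have "\<dots> \<le> D ^ (2 * K) / real n ^ (card (set xs \<union> set ys) + 1)"
      using that n by (intro frac_le power_increasing) (auto simp: D_def)
    finally show ?thesis by (simp add: d_def D_def)
  qed
  have two: "prob (light n zs \<inter> light n zs') \<le> t ^ card (edges zs \<union> edges zs')"
    if "zs \<in> C n" "zs' \<in> C n" "length zs \<le> K" "length zs' \<le> K" for zs zs'
    unfolding light_def using that
    by (intro iid_exponential_two_sums_le[OF iid] edges_subset t t0) auto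
  have one: "prob (light n zs) \<le> t ^ length zs" if "zs \<in> C n" "length zs \<le> K" for zs
    using two[of zs zs] that by (simp add: card_edges)
  have "prob (light n xs) * prob (light n ys) \<le> t ^ length xs * t ^ length ys"
    using xs ys t0 by (intro mult_mono one) auto
  also have "\<dots> = t ^ (length xs + length ys)" by (simp add: power_add)
  also have "\<dots> \<le> d"
  proof (rule pw)
    have "card (set xs \<inter> set ys) \<ge> 1" using share by (simp add: Suc_le_eq card_gt_0_iff)
    moreover have "card (set xs) + card (set ys) = card (set xs \<union> set ys) + card (set xs \<inter> set ys)"
      by (rule card_Un_Int) auto
    moreover have "card (set xs) = length xs" "card (set ys) = length ys"
      using xs ys distinctC by (auto simp: distinct_card)
    ultimately show "card (set xs \<union> set ys) + 1 \<le> length xs + length ys" by linarith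
  qed (use xs ys in auto)
  finally show "prob (light n xs) * prob (light n ys) \<le> d" .
  assume ne: "xs \<noteq> ys"
  have "prob (light n xs \<inter> light n ys) \<le> t ^ card (edges xs \<union> edges ys)"
    using xs ys by (intro two) auto
  also have "\<dots> \<le> d"
  proof (rule pw)
    show "card (set xs \<union> set ys) + 1 \<le> card (edges xs \<union> edges ys)"
    proof (rule card_edges_union_bound[OF ends])
      show "edges xs \<noteq> edges ys" using inj ne xs ys by (auto simp: inj_on_def)
    qed (use xs ys share distinctC inj_arcs in auto)
    have "card (edges xs \<union> edges ys) \<le> card (edges xs) + card (edges ys)" by (rule card_Un_le)
    then show "card (edges xs \<union> edges ys) \<le> 2 * K" using xs ys by (simp add: card_edges)
  qed
  finally show "prob (light n xs \<inter> light n ys) \<le> d" .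
qed

section \<open>Poisson limit for cycles of bounded length\<close>

lemma prob_no_short_light_tendsto:
  "(\<lambda>n. measure (M n) (space (M n) - (\<Union>xs\<in>{xs\<in>C n. length xs \<le> K}. light n xs)))
     \<longlonglongrightarrow> exp (- limit_mean c K)"
proof -
  define CK where "CK n = {xs\<in>C n. length xs \<le> K}" for n
  define \<mu> where "\<mu> n = (\<Sum>xs\<in>CK n. measure (M n) (light n xs))" for n
  define P where "P n = measure (M n) (space (M n) - (\<Union>xs\<in>CK n. light n xs))" for n
  have finCK: "finite (CK n)" for n using finiteC by (simp add: CK_def)
  have "\<mu> = (\<lambda>n. \<Sum>k\<in>{m..K}. \<Sum>xs\<in>{xs\<in>C n. length xs = k}. measure (M n) (light n xs))"
  proof
    fix n
    have "\<mu> n = (\<Sum>k\<in>{m..K}. \<Sum>xs\<in>{xs\<in>CK n. length xs = k}. measure (M n) (light n xs))"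
      unfolding \<mu>_def using finCK len by (intro sum.group[symmetric]) (auto simp: CK_def)
    also have "\<dots> = (\<Sum>k\<in>{m..K}. \<Sum>xs\<in>{xs\<in>C n. length xs = k}. measure (M n) (light n xs))"
      by (intro sum.cong) (auto simp: CK_def)
    finally show "\<mu> n = \<dots>" .
  qed
  moreover have "(\<lambda>n. \<Sum>k\<in>{m..K}. \<Sum>xs\<in>{xs\<in>C n. length xs = k}. measure (M n) (light n xs))
      \<longlonglongrightarrow> (\<Sum>k\<in>{m..K}. \<kappa> * tree_term c k)"
    by (intro tendsto_sum sum_prob_light_tendsto) auto
  ultimately have \<mu>: "\<mu> \<longlonglongrightarrow> limit_mean c K"
    by (simp only: limit_mean_def sum_distrib_left)
  obtain Q where Q: "Q \<ge> 0" "\<And>n. n \<ge> 1 \<Longrightarrow>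
      (\<Sum>(xs, ys)\<in>CK n \<times> CK n. 1 / real n ^ (card (set xs \<union> set ys) + 1)) \<le> Q / real n"
  proof -
    have "set xs \<subseteq> {..<n} \<and> length xs \<le> K" if "xs \<in> CK n" for n xs
      using that C[of n] by (auto simp: CK_def rooted_cycles_def)
    from sum_list_pairs_inverse_power_bound[of CK K, OF this] show ?thesis using that by blast
  qed
  define D where "D = max 1 (real K * c) ^ (2 * K)"
  have D: "D \<ge> 0" by (simp add: D_def)
  \<comment> \<open>The factor 2 stands for the product and the joint probability of each pair;
    \<open>D\<close> and \<open>Q\<close> do not depend on \<open>n\<close>.\<close>
  have err: "\<bar>P n - exp (- \<mu> n)\<bar> \<le> 2 * D * Q / real n" if n: "n \<ge> 1" for n
  proof -
    interpret prob_space "M n" using iid[of n] by (simp add: iid_exponential_def)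
    define R where "R xs ys \<longleftrightarrow> set xs \<inter> set ys \<noteq> {}" for xs ys :: "nat list"
    define d where "d xs ys = D / real n ^ (card (set xs \<union> set ys) + 1)" for xs ys :: "nat list"
    have d0: "d xs ys \<ge> 0" for xs ys using D by (simp add: d_def)
    have "\<bar>P n - exp (- \<mu> n)\<bar> \<le> (\<Sum>xs\<in>CK n. \<Sum>ys\<in>{ys\<in>CK n. R xs ys}.
       prob (light n xs) * prob (light n ys) + (if ys = xs then 0 else prob (light n xs \<inter> light n ys)))"
      unfolding P_def \<mu>_def
    proof (rule prob_none_poisson_approx)
      show "R xs xs" if "xs \<in> CK n" for xs
        using that len[of xs n] m by (auto simp: R_def CK_def)
      show "prob (light n xs \<inter> (space (M n) - (\<Union>ys\<in>S. light n ys))) =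
          prob (light n xs) * prob (space (M n) - (\<Union>ys\<in>S. light n ys))"
        if "xs \<in> CK n" "S \<subseteq> {ys \<in> CK n. \<not> R xs ys}" for xs S
      proof -
        have *: "ys \<in> C n" "edges ys \<inter> edges xs = {}" if "ys \<in> S" for ys
          using \<open>S \<subseteq> _\<close> that edges_disjoint[of ys xs] by (auto simp: R_def CK_def)
        have "xs \<in> C n" using that by (simp add: CK_def)
        moreover have "finite S" using that finCK finite_subset[of S "CK n"] by auto
        ultimately show ?thesis unfolding light_def using *
          by (intro iid_exponential_indep_sums[OF iid] conjI edges_subset) auto
      qed
    qed (use finCK light_events in \<open>auto simp: CK_def\<close>)
    also have "\<dots> \<le> (\<Sum>xs\<in>CK n. \<Sum>ys\<in>{ys\<in>CK n. R xs ys}. 2 * d xs ys)"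
    proof (intro sum_mono)
      fix xs ys assume "xs \<in> CK n" "ys \<in> {ys\<in>CK n. R xs ys}"
      then show "prob (light n xs) * prob (light n ys) + (if ys = xs then 0 else prob (light n xs \<inter> light n ys)) \<le> 2 * d xs ys"
        using prob_two_light_le[of xs n K ys, folded D_def, folded d_def] n d0[of xs ys]
        by (auto simp: CK_def R_def)
    qed
    also have "\<dots> \<le> (\<Sum>xs\<in>CK n. \<Sum>ys\<in>CK n. 2 * d xs ys)"
      using finCK d0 by (intro sum_mono sum_mono2) auto
    also have "\<dots> = 2 * D * (\<Sum>(xs, ys)\<in>CK n \<times> CK n. 1 / real n ^ (card (set xs \<union> set ys) + 1))"
      by (simp add: sum.cartesian_product sum_distrib_left d_def case_prod_unfold)
    also have "\<dots> \<le> 2 * D * (Q / real n)" using D Q(2)[OF n] by (intro mult_left_mono) auto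
    finally show ?thesis by simp
  qed
  have "(\<lambda>n. P n - exp (- \<mu> n)) \<longlonglongrightarrow> 0"
  proof (rule Lim_null_comparison)
    show "\<forall>\<^sub>F n in sequentially. norm (P n - exp (- \<mu> n)) \<le> 2 * D * Q / real n"
      using eventually_ge_at_top[of 1] by eventually_elim (simp add: err)
  qed (rule lim_const_over_n)
  then have "(\<lambda>n. P n - exp (- \<mu> n) + exp (- \<mu> n)) \<longlonglongrightarrow> 0 + exp (- limit_mean c K)"
    by (intro tendsto_intros \<mu>)
  then show ?thesis by (simp add: P_def CK_def)
qed

section \<open>Long cycles and the limit in the length bound\<close>

lemma prob_long_light_le:
  assumes c1: "c \<le> 1 / exp 1" and n: "n \<ge> 1"
  shows "measure (M n) (\<Union>xs\<in>{xs\<in>C n. K < length xs}. light n xs) \<le> \<kappa> * (\<Sum>k. tree_term c (k + Suc K))"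
proof -
  interpret prob_space "M n" using iid[of n] by (simp add: iid_exponential_def)
  \<comment> \<open>Lengths do not exceed \<open>n\<close>. The looser end \<open>Suc K + n\<close>
    turns the range, after a shift by \<open>Suc K\<close>, into the first \<open>n\<close> terms of
    the tail series.\<close>
  let ?L = "{xs\<in>C n. K < length xs}" and ?I = "{max m (Suc K)..<Suc K + n}"
  have "length xs < Suc K + n" if "xs \<in> C n" for xs
  proof -
    have "length xs = card (set xs)" using distinctC[OF that] by (simp add: distinct_card)
    also have "\<dots> \<le> card {..<n}" using C that by (intro card_mono) (auto simp: rooted_cycles_def)
    finally show ?thesis by simp
  qed
  then have lenI: "length ` ?L \<subseteq> ?I" using len by auto
  have "prob (\<Union>xs\<in>?L. light n xs) \<le> (\<Sum>xs\<in>?L. prob (light n xs))"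
    using finiteC light_events by (intro finite_measure_subadditive_finite) auto
  also have "\<dots> = (\<Sum>k\<in>?I. \<Sum>xs\<in>{xs\<in>?L. length xs = k}. prob (light n xs))"
    using finiteC lenI by (intro sum.group[symmetric]) auto
  also have "\<dots> = (\<Sum>k\<in>?I. \<Sum>xs\<in>{xs\<in>C n. length xs = k}. prob (light n xs))"
    by (intro sum.cong) auto
  also have "\<dots> \<le> (\<Sum>k\<in>?I. \<kappa> * tree_term c k)"
    using n by (intro sum_mono sum_prob_light_le) auto
  also have "\<dots> \<le> (\<Sum>k\<in>{Suc K..<Suc K + n}. \<kappa> * tree_term c k)"
    using \<kappa> tree_term_nonneg[OF c] by (intro sum_mono2) auto
  also have "\<dots> = \<kappa> * (\<Sum>k<n. tree_term c (k + Suc K))"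
  proof -
    have "(\<Sum>k\<in>{Suc K..<Suc K + n}. tree_term c k) = (\<Sum>k<n. tree_term c (k + Suc K))"
      using sum.shift_bounds_nat_ivl[of "tree_term c" 0 "Suc K" n] by (simp add: lessThan_atLeast0 add.commute)
    then show ?thesis by (simp flip: sum_distrib_left)
  qed
  also have "\<dots> \<le> \<kappa> * (\<Sum>k. tree_term c (k + Suc K))"
    using \<kappa> summable_tree_term[OF c c1] tree_term_nonneg[OF c]
    by (intro mult_left_mono sum_le_suminf) (auto simp only: summable_iff_shift)
  finally show ?thesis .
qed

lemma limit_mean_tendsto:
  assumes "c \<le> 1 / exp 1"
  shows "limit_mean c \<longlonglongrightarrow> \<kappa> * (suminf (tree_term c) - (\<Sum>k<m. tree_term c k))"
proof -
  have s: "summable (tree_term c)" by (rule summable_tree_term[OF c assms])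
  have "\<forall>\<^sub>F K in sequentially. \<kappa> * ((\<Sum>k<Suc K. tree_term c k) - (\<Sum>k<m. tree_term c k)) = limit_mean c K"
    using eventually_ge_at_top[of m]
  proof eventually_elim
    case (elim K)
    then have "{..<Suc K} - {..<m} = {m..K}" "{..<m} \<subseteq> {..<Suc K}" by auto
    then show ?case using sum_diff[of "{..<Suc K}" "{..<m}" "tree_term c"] by (simp add: limit_mean_def)
  qed
  moreover have "(\<lambda>K. \<kappa> * ((\<Sum>k<Suc K. tree_term c k) - (\<Sum>k<m. tree_term c k)))
     \<longlonglongrightarrow> \<kappa> * (suminf (tree_term c) - (\<Sum>k<m. tree_term c k))"
    using summable_LIMSEQ[OF s] by (intro tendsto_intros) (rule LIMSEQ_Suc)
  ultimately show ?thesis by (rule Lim_transform_eventually[rotated])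
qed

lemma limit_mean_at_top:
  assumes "1 / exp 1 < c"
  shows "filterlim (limit_mean c) at_top sequentially"
proof -
  have "\<not> summable (\<lambda>k. tree_term c (k + m))"
    using not_summable_tree_term[OF assms] by (simp add: summable_iff_shift)
  then have unb: "\<exists>n. B < (\<Sum>k<n. tree_term c (k + m))" for B
    using bounded_imp_summable[of "\<lambda>k. tree_term c (k + m)" B] tree_term_nonneg[OF c]
    by (metis lessThan_Suc_atMost not_le)
  show ?thesis unfolding filterlim_at_top
  proof
    fix Z
    obtain n where n: "Z / \<kappa> < (\<Sum>k<n. tree_term c (k + m))" using unb by blast
    show "\<forall>\<^sub>F K in sequentially. Z \<le> limit_mean c K"
      using eventually_ge_at_top[of "n + m"]
    proof eventually_elim
      case (elim K)
      have "(\<Sum>k<n. tree_term c (k + m)) = (\<Sum>k\<in>{m..<n + m}. tree_term c k)"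
        using sum.shift_bounds_nat_ivl[of "tree_term c" 0 m n] by (simp add: lessThan_atLeast0)
      also have "\<dots> \<le> (\<Sum>k\<in>{m..K}. tree_term c k)"
        using elim tree_term_nonneg[OF c] by (intro sum_mono2) auto
      finally have "\<kappa> * (Z / \<kappa>) \<le> \<kappa> * (\<Sum>k\<in>{m..K}. tree_term c k)"
        using n \<kappa> by (intro mult_left_mono) auto
      then show ?case using \<kappa> by (simp add: limit_mean_def)
    qed
  qed
qed

text \<open>The probability lies between that of a short light cycle and the same plus the tail of
  the series. Both sides converge in \<open>n\<close> for fixed \<open>K\<close>, and their limits
  meet as \<open>K\<close> grows. Above the threshold the lower bounds alone tend to 1.\<close>

theorem prob_light_cycle_tendsto:
  "(\<lambda>n. measure (M n) {\<omega> \<in> space (M n). \<exists>xs\<in>C n. (\<Sum>e\<in>edges xs. w n e \<omega>) \<le> real (length xs) * (c / real n)})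
    \<longlonglongrightarrow> (if c \<le> 1 / exp 1
        then 1 - exp (- (\<kappa> * (suminf (tree_term c) - (\<Sum>k<m. tree_term c k)))) else 1)"
proof -
  define P where "P n = measure (M n) (\<Union>xs\<in>C n. light n xs)" for n
  define S where "S K n = measure (M n) (\<Union>xs\<in>{xs\<in>C n. length xs \<le> K}. light n xs)" for K n
  have S_lim: "S K \<longlonglongrightarrow> 1 - exp (- limit_mean c K)" for K
  proof -
    have "measure (M n) (space (M n) - (\<Union>xs\<in>{xs\<in>C n. length xs \<le> K}. light n xs)) = 1 - S K n" for n
    proof -
      interpret prob_space "M n" using iid[of n] by (simp add: iid_exponential_def)
      show ?thesis unfolding S_def using finiteC light_events by (intro prob_compl) auto
    qed
    then have "(\<lambda>n. 1 - S K n) \<longlonglongrightarrow> exp (- limit_mean c K)"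
      using prob_no_short_light_tendsto[of K] by simp
    then have "(\<lambda>n. 1 - (1 - S K n)) \<longlonglongrightarrow> 1 - exp (- limit_mean c K)" by (intro tendsto_intros)
    then show ?thesis by simp
  qed
  have SP: "S K n \<le> P n" "P n \<le> 1" for K n
  proof -
    interpret prob_space "M n" using iid[of n] by (simp add: iid_exponential_def)
    show "S K n \<le> P n" unfolding S_def P_def using finiteC light_events
      by (intro finite_measure_mono) auto
    show "P n \<le> 1" unfolding P_def by (rule prob_le_1)
  qed
  define L where "L = (if c \<le> 1 / exp 1
        then 1 - exp (- (\<kappa> * (suminf (tree_term c) - (\<Sum>k<m. tree_term c k)))) else 1)"
  have lim1: "(\<lambda>K. 1 - exp (- limit_mean c K)) \<longlonglongrightarrow> L"
  proof (cases "c \<le> 1 / exp 1")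
    case True
    then show ?thesis using limit_mean_tendsto[OF True] by (auto simp: L_def intro!: tendsto_intros)
  next
    case False
    have "(\<lambda>K. exp (- limit_mean c K)) \<longlonglongrightarrow> 0"
      by (rule filterlim_compose[OF exp_at_bot])
        (use limit_mean_at_top False in \<open>auto simp: filterlim_uminus_at_top\<close>)
    then have "(\<lambda>K. 1 - exp (- limit_mean c K)) \<longlonglongrightarrow> 1 - 0" by (intro tendsto_intros)
    then show ?thesis using False by (simp add: L_def)
  qed
  have tail: "(\<lambda>K. \<kappa> * (\<Sum>k. tree_term c (k + Suc K))) \<longlonglongrightarrow> 0" if c1: "c \<le> 1 / exp 1"
  proof -
    have "(\<lambda>K. \<kappa> * (\<Sum>k. tree_term c (k + K))) \<longlonglongrightarrow> \<kappa> * 0"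
      by (intro tendsto_mult_left suminf_exist_split2 summable_tree_term c c1)
    then show ?thesis using LIMSEQ_Suc by fastforce
  qed
  have PS: "P n \<le> S K n + \<kappa> * (\<Sum>k. tree_term c (k + Suc K))" if "c \<le> 1 / exp 1" "n \<ge> 1" for K n
  proof -
    have "(\<Union>xs\<in>C n. light n xs) =
        (\<Union>xs\<in>{xs\<in>C n. length xs \<le> K}. light n xs) \<union> (\<Union>xs\<in>{xs\<in>C n. K < length xs}. light n xs)"
      using linorder_le_less_linear by blast
    moreover have "measure (M n) \<dots> \<le> S K n + measure (M n) (\<Union>xs\<in>{xs\<in>C n. K < length xs}. light n xs)"
      unfolding S_def using finiteC light_events by (intro measure_Un_le) auto
    ultimately show ?thesis using prob_long_light_le[OF that, of K] by (simp add: P_def)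
  qed
  have "P \<longlonglongrightarrow> L"
  proof (rule order_tendstoI)
    fix a assume "a < L"
    then obtain K where "a < 1 - exp (- limit_mean c K)"
      using eventually_happens[OF order_tendstoD(1)[OF lim1]] by auto
    from order_tendstoD(1)[OF S_lim this] show "\<forall>\<^sub>F n in sequentially. a < P n"
      by eventually_elim (rule less_le_trans[OF _ SP(1)])
  next
    fix a assume a: "L < a"
    show "\<forall>\<^sub>F n in sequentially. P n < a"
    proof (cases "c \<le> 1 / exp 1")
      case True
      define r where "r K = \<kappa> * (\<Sum>k. tree_term c (k + Suc K))" for K
      have "(\<lambda>K. 1 - exp (- limit_mean c K) + r K) \<longlonglongrightarrow> L + 0"
        unfolding r_def by (intro tendsto_add lim1 tail True)
      from order_tendstoD(2)[OF this] a obtain K where "1 - exp (- limit_mean c K) + r K < a"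
        using eventually_happens by fastforce
      moreover have "(\<lambda>n. S K n + r K) \<longlonglongrightarrow> 1 - exp (- limit_mean c K) + r K"
        by (intro tendsto_intros S_lim)
      ultimately have "\<forall>\<^sub>F n in sequentially. S K n + r K < a" by (rule order_tendstoD(2)[rotated])
      then show ?thesis using eventually_ge_at_top[of 1]
      proof eventually_elim
        case (elim n)
        then show ?case using PS[OF True, of n K] by (simp add: r_def)
      qed
    next
      case False
      then have "P n < a" for n using a SP(2)[of n] by (simp add: L_def)
      then show ?thesis by simp
    qed
  qed
  moreover have "{\<omega> \<in> space (M n). \<exists>xs\<in>C n. (\<Sum>e\<in>edges xs. w n e \<omega>) \<le> real (length xs) * (c / real n)}
      = (\<Union>xs\<in>C n. light n xs)" for n
    by (auto simp: light_def)
  ultimately show ?thesis by (simp add: P_def[abs_def] L_def)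
qed

end

end

section \<open>The directed and the undirected model\<close>

interpretation directed: cycle_family "\<lambda>a. a" rooted_cycles 1 2
proof
  show "real (card {xs \<in> rooted_cycles n. length xs = k}) = 1 * (real (n choose k) * fact (k - 1))"
    if "2 \<le> k" for n k
    using card_rooted_cycles[OF that, of n] by simp
  show "inj_on (\<lambda>xs. (\<lambda>a. a) ` cyc_arcs xs) (rooted_cycles n)" for n
    by (simp add: inj_on_cyc_arcs_rooted)
qed (auto simp: rooted_cycles_def)

interpretation undirected: cycle_family undirect oriented_cycles "1 / 2" 3
proof
  show "real (card {xs \<in> oriented_cycles n. length xs = k}) = 1 / 2 * (real (n choose k) * fact (k - 1))"
    if "3 \<le> k" for n k
  proof -
    have "real (2 * card {xs \<in> oriented_cycles n. length xs = k}) = real ((n choose k) * fact (k - 1))"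
      by (simp only: card_oriented_cycles[OF that])
    then show ?thesis by simp
  qed
  show "inj_on (\<lambda>xs. undirect ` cyc_arcs xs) (oriented_cycles n)" for n
    by (rule inj_on_edges_oriented)
  show "inj_on undirect (cyc_arcs xs)" if "xs \<in> oriented_cycles n" for xs n
    using that by (intro inj_on_undirect_cyc_arcs) (auto simp: oriented_cycles_def rooted_cycles_def)
qed (auto simp: oriented_cycles_def)

text \<open>The series differ by a vanishing term at index 0; splitting it off uses convergence,
  available in the branch where the tree function occurs.\<close>

lemma tree_function_conv_tree_term:
  assumes "0 \<le> c" "c \<le> 1 / exp 1"
  shows "tree_function c = suminf (tree_term c)"
proof -
  have "tree_function c = (\<Sum>j. tree_term c (Suc j))"
    by (simp only: tree_function_def tree_term_Suc)
  also have "\<dots> = suminf (tree_term c)"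
    using suminf_split_head[OF summable_tree_term[OF assms]] by simp
  finally show ?thesis .
qed

theorem theorem5p1:
  fixes c :: real
    and M :: "nat \<Rightarrow> 'a measure" and w :: "nat \<Rightarrow> nat \<times> nat \<Rightarrow> 'a \<Rightarrow> real"
    and N :: "nat \<Rightarrow> 'b measure" and v :: "nat \<Rightarrow> nat set \<Rightarrow> 'b \<Rightarrow> real"
  assumes "c \<ge> 0"
  shows
    "((\<forall>n. iid_exponential (M n) (arcs (directed_complete_graph n)) (w n)) \<longrightarrow>
        (\<lambda>n. measure (M n) {\<omega> \<in> space (M n).
                \<exists>p \<in> directed_cycles n. mean_weight (\<lambda>e. w n e \<omega>) p \<le> c / real n})
          \<longlonglongrightarrow> (if c \<le> 1 / exp 1 then 1 - exp (- tree_function c + c) else 1)) \<and>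
     ((\<forall>n. iid_exponential (N n) (undirected_edges n) (v n)) \<longrightarrow>
        (\<lambda>n. measure (N n) {\<omega> \<in> space (N n).
                \<exists>p \<in> undirected_cycles n. mean_weight (\<lambda>e. v n e \<omega>) p \<le> c / real n})
          \<longlonglongrightarrow> (if c \<le> 1 / exp 1 then 1 - exp ((- tree_function c + c + c^2) / 2) else 1))"
proof (intro conjI impI)
  \<comment> \<open>The terms at k = 1 and k = 2 are c and c^2. They belong to lengths at which the
    model has no cycle, which is the origin of the corrections to the tree function.\<close>
  have t: "(\<Sum>k<2. tree_term c k) = c" "(\<Sum>k<3. tree_term c k) = c + c^2"
    by (simp_all add: tree_term_def eval_nat_numeral)
  {
    assume "\<forall>n. iid_exponential (M n) (arcs (directed_complete_graph n)) (w n)"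
    then have "iid_exponential (M n) ((\<lambda>a. a) ` arcs (directed_complete_graph n)) (w n)" for n by simp
    from directed.prob_light_cycle_tendsto[OF this assms]
    show "(\<lambda>n. measure (M n) {\<omega> \<in> space (M n).
                \<exists>p \<in> directed_cycles n. mean_weight (\<lambda>e. w n e \<omega>) p \<le> c / real n})
          \<longlonglongrightarrow> (if c \<le> 1 / exp 1 then 1 - exp (- tree_function c + c) else 1)"
      unfolding light_directed_cycle_iff t using tree_function_conv_tree_term[OF assms]
      \<comment> \<open>The congruence rule supplies \<open>c \<le> 1 / exp 1\<close> inside the
        first branch, where the tree function is rewritten.\<close>
      by (simp cong: if_cong)
  next
    assume "\<forall>n. iid_exponential (N n) (undirected_edges n) (v n)"
    moreover have "undirected_edges n = undirect ` arcs (directed_complete_graph n)" for n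
      unfolding undirected_edges_def undirect_def by auto
    ultimately have "iid_exponential (N n) (undirect ` arcs (directed_complete_graph n)) (v n)" for n by simp
    note lim = undirected.prob_light_cycle_tendsto[OF this assms]
    have "- (1 / 2 * (suminf (tree_term c) - (c + c^2))) = (- suminf (tree_term c) + c + c^2) / 2"
      by (simp add: field_simps)
    with lim show "(\<lambda>n. measure (N n) {\<omega> \<in> space (N n).
                \<exists>p \<in> undirected_cycles n. mean_weight (\<lambda>e. v n e \<omega>) p \<le> c / real n})
          \<longlonglongrightarrow> (if c \<le> 1 / exp 1 then 1 - exp ((- tree_function c + c + c^2) / 2) else 1)"
      unfolding light_undirected_cycle_iff t using tree_function_conv_tree_term[OF assms]
      by (simp only: cong: if_cong)
  }
qed

end
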